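(* There are universal constants $c,C>0$ such that for every $\beta\ge1$, $\tau>0$ and all integers $n\ge1$, $$\mathbf P_n^\beta\left(\left\{\mathrm s_n<c\,n^{-\frac{2+\tau}\beta}\right\}\right)<C\big(n^{-\tau}+e^{-n\beta/C}\big).$$ In particular, if $c_0>0$ and $\beta_n\ge c_0\log n$ (for all large $n$), then there is a positive constant $s_0=s_0(c_0)$ such that $$\liminf_{n\to\infty}\mathrm s_n\ge s_0\qquad\text{almost surely.}$$
   Context: For $\beta>0$ and $n\ge1$, $\mathbf P_n^\beta$ is the probability measure on $\mathbb R^n$ with density $$p_n^\beta(x_1,\dots,x_n)=\frac1{Z_{\beta,n}}\prod_{k<j}|x_k-x_j|^\beta\, e^{-n\frac\beta2\sum_{j=1}^n\frac12x_j^2},$$ where $Z_{\beta,n}$ is the normalizing constant. For a sequence $(\beta_n)$ of positive numbers, "almost surely" refers to the product measure $\mathbf P=\prod_{n=1}^\infty\mathbf P_n^{\beta_n}$ on sequences of configurations. With $\sigma(x)=\frac1{2\pi}\sqrt{(4-x^2)_+}$ and $\sigma_n(x)=\max\{\sigma(x),n^{-1/3}\}$, the normalized spacing of a configuration $\{x_j\}_{j=1}^n$ is $$\mathrm s_n=\min_{j\ne k}\{n\sigma_n(x_j)\cdot|x_j-x_k|\}$$ (with $\mathrm s_1=+\infty$). *)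

theory Defs
  imports "HOL-Probability.Probability"
begin

text \<open>
  Configurations of \<open>n\<close> points, i.e. elements of \<open>\<real>\<^sup>n\<close>, are functions on the index
  set \<open>{1..n}\<close> (extensional outside of it), and Lebesgue measure on \<open>\<real>\<^sup>n\<close> is the
  product measure \<open>lebesgue_pow n\<close>.
\<close>

abbreviation lebesgue_pow :: "nat \<Rightarrow> (nat \<Rightarrow> real) measure" where
  "lebesgue_pow n \<equiv> (\<Pi>\<^sub>M j\<in>{1..n}. lborel)"

definition gbe_weight :: "real \<Rightarrow> nat \<Rightarrow> (nat \<Rightarrow> real) \<Rightarrow> real" where
  "gbe_weight \<beta> n x =
     (\<Prod>j\<in>{1..n}. \<Prod>k\<in>{1..<j}. \<bar>x k - x j\<bar> powr \<beta>)
     * exp (- (real n * (\<beta> / 2) * (\<Sum>j\<in>{1..n}. (1 / 2) * (x j)\<^sup>2)))"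

definition gbe_Z :: "real \<Rightarrow> nat \<Rightarrow> real" where
  "gbe_Z \<beta> n = (\<integral>x. gbe_weight \<beta> n x \<partial>lebesgue_pow n)"

definition gbe_density :: "real \<Rightarrow> nat \<Rightarrow> (nat \<Rightarrow> real) \<Rightarrow> real" where
  "gbe_density \<beta> n x = (1 / gbe_Z \<beta> n) * gbe_weight \<beta> n x"

definition gbe :: "real \<Rightarrow> nat \<Rightarrow> (nat \<Rightarrow> real) measure" where
  "gbe \<beta> n = density (lebesgue_pow n) (\<lambda>x. ennreal (gbe_density \<beta> n x))"

text \<open>The index starts at \<open>n = 1\<close>; the \<open>n\<close>-th coordinate is a configuration of \<open>n\<close> points.\<close>

definition gbe_seq :: "(nat \<Rightarrow> real) \<Rightarrow> (nat \<Rightarrow> nat \<Rightarrow> real) measure" where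
  "gbe_seq \<beta> = (\<Pi>\<^sub>M n\<in>{1..}. gbe (\<beta> n) n)"

definition semicircle :: "real \<Rightarrow> real" where
  "semicircle x = (1 / (2 * pi)) * sqrt (max (4 - x\<^sup>2) 0)"

definition semicircle_trunc :: "nat \<Rightarrow> real \<Rightarrow> real" where
  "semicircle_trunc n x = max (semicircle x) (real n powr (- (1 / 3)))"

text \<open>
  The infimum runs over a finite set of pairs, so it is a minimum for \<open>n \<ge> 2\<close>; for
  \<open>n = 1\<close> it is over the empty set and equals \<open>\<infinity>\<close>.
\<close>

definition spacing :: "nat \<Rightarrow> (nat \<Rightarrow> real) \<Rightarrow> ereal" where
  "spacing n x =
     (INF (j, k) \<in> {(j, k). j \<in> {1..n} \<and> k \<in> {1..n} \<and> j \<noteq> k}.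
        ereal (real n * semicircle_trunc n (x j) * \<bar>x j - x k\<bar>))"

end

theory Submission
  imports Defs "HOL-Complex_Analysis.Complex_Analysis" "HOL-Real_Asymp.Real_Asymp"
begin

text \<open>
  As a function of a single coordinate \<open>t\<close>, the density is a constant multiple of \<open>\<bar>F t\<bar>\<^sup>\<beta>\<close>, where
  \<open>F z = (\<Prod>k. z - x k) exp (- n z\<^sup>2 / 4)\<close> is an entire weighted polynomial vanishing at the other
  particles. The Joukowski map \<open>z = u + 1 / u\<close> and the maximum principle on the unit disc bound
  \<open>F\<close> on the disc of radius \<open>1 / (n \<sigma>\<^sub>n (x\<^sub>0))\<close> about any real \<open>x\<^sub>0\<close> by a constant times
  \<open>sup\<^bsub>[-2,2]\<^esub> \<bar>F\<bar> / (1 + x\<^sub>0\<^sup>2)\<close>. Cauchy's estimate then gives a local Lipschitz bound, with two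
  consequences: if \<open>x\<^sub>j\<close> is very close to a zero of \<open>F\<close>, then \<open>\<bar>F x\<^sub>j\<bar>\<close> is small compared with the
  supremum, and the supremum of \<open>\<bar>F\<bar>\<^sup>\<beta>\<close> is at most of order \<open>n \<integral>\<bar>F\<bar>\<^sup>\<beta>\<close>. Hence on the small spacing
  event the density at \<open>x\<close> is at most \<open>n\<^bsup>-1-\<tau>\<^esup> (1 + x\<^sub>j\<^sup>2)\<^bsup>-1\<^esup>\<close> times its integral over the \<open>j\<close>-th
  coordinate, for some \<open>j\<close>. Integrating and summing over \<open>j\<close> gives the bound \<open>\<pi> n\<^bsup>-\<tau>\<^esup>\<close>; the factor
  \<open>(1 + x\<^sub>j\<^sup>2)\<^bsup>-1\<^esup>\<close> makes a separate estimate for particles far from \<open>[-2,2]\<close> superfluous. The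
  almost sure statement is the Borel--Cantelli lemma with \<open>\<tau> = 2\<close>.
\<close>

subsection \<open>Weighted polynomials and the Joukowski map\<close>

text \<open>The candidates are the two roots of \<open>u\<^sup>2 - z * u + 1\<close>. Their product
  is 1, so they cannot both lie outside the closed unit disc.\<close>

lemma joukowski_preimage:
  fixes z :: complex
  obtains u where "u \<noteq> 0" "norm u \<le> 1" "z = u + 1 / u"
proof -
  define s where "s = csqrt (z\<^sup>2 - 4)"
  have s2: "s\<^sup>2 = z\<^sup>2 - 4" by (simp add: s_def)
  define v where "v = (z + s) / 2"
  define w where "w = (z - s) / 2"
  have vw: "v * w = 1"
    using s2 by (simp add: v_def w_def field_simps power2_eq_square)
  have sum: "z = v + w" by (simp add: v_def w_def field_simps)
  have nz: "v \<noteq> 0" "w \<noteq> 0" using vw by auto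
  have inv: "w = 1 / v" "v = 1 / w" using vw nz by (auto simp: field_simps)
  have "norm v * norm w = 1" using vw by (metis norm_mult norm_one)
  then have "norm v \<le> 1 \<or> norm w \<le> 1"
    using mult_strict_mono[of 1 "norm v" 1 "norm w"] by fastforce
  moreover have "z = v + 1 / v" "z = w + 1 / w"
    by (metis sum inv(1)) (metis sum inv(2) add.commute)
  ultimately show thesis using that nz by blast
qed

text \<open>Applied to \<open>x + \<i> y = u + 1 / u\<close>, \<open>u = a exp (\<i> \<theta>)\<close>, with \<open>S = sin\<^sup>2 \<theta>\<close> and \<open>q = (1 / a - a)\<^sup>2\<close>.\<close>

lemma joukowski_sin_bound:
  fixes x y S q :: real
  assumes "0 \<le> S" "0 \<le> q" and x: "x\<^sup>2 = (q + 4) * (1 - S)" and y: "y\<^sup>2 = q * S"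
  shows "S \<le> max (4 - x\<^sup>2) 0 / 4 + \<bar>y\<bar>"
proof (rule ccontr)
  define P where "P = max (4 - x\<^sup>2) 0"
  assume "\<not> ?thesis"
  then have S: "S > P / 4 + \<bar>y\<bar>" by (simp add: P_def)
  have P: "0 \<le> P" "4 - x\<^sup>2 \<le> P" by (auto simp: P_def)
  \<comment> \<open>Eliminating \<open>q\<close> leaves a quadratic equation for \<open>S\<close>;
    beyond \<open>P / 4 + \<bar>y\<bar>\<close> its left side outgrows the right.\<close>
  have "4 * S\<^sup>2 = (4 - x\<^sup>2 - y\<^sup>2) * S + y\<^sup>2"
    unfolding x y by (simp add: algebra_simps power2_eq_square)
  also have "\<dots> \<le> P * S + y\<^sup>2"
    using P \<open>0 \<le> S\<close> zero_le_power2[of y] by (intro add_mono mult_right_mono) linarith+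
  finally have 1: "4 * S\<^sup>2 \<le> P * S + y\<^sup>2" .
  have "4 * S * S > 4 * S * (P / 4 + \<bar>y\<bar>)"
    using S P by (intro mult_strict_left_mono) auto
  moreover have "S * \<bar>y\<bar> \<ge> \<bar>y\<bar> * \<bar>y\<bar>"
    using S P by (intro mult_right_mono) auto
  moreover have "0 \<le> S * \<bar>y\<bar>" using \<open>0 \<le> S\<close> by simp
  ultimately show False
    using 1 by (simp add: algebra_simps power2_eq_square abs_mult_self_eq)
qed

text \<open>The slope of \<open>4 - x\<^sup>2\<close> is at most 4 in modulus on [-2, 2], and the
  truncation is constant outside. This carries edge estimates from the real part of a nearby complex
  point back to \<open>x0\<close>.\<close>

lemma semicircle_edge_lipschitz:
  fixes x x0 r :: real
  assumes "\<bar>x - x0\<bar> \<le> r"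
  shows "max (4 - x\<^sup>2) 0 \<le> max (4 - x0\<^sup>2) 0 + 4 * r"
proof (cases "\<bar>x\<bar> < 2")
  case True
  \<comment> \<open>Clipping \<open>\<bar>x0\<bar>\<close> at 2 makes \<open>4 - m\<^sup>2\<close>
    the truncated value at \<open>x0\<close> on both sides of the edge.\<close>
  define m where "m = min \<bar>x0\<bar> 2"
  have "m - \<bar>x\<bar> \<le> r" using assms unfolding m_def by linarith
  have r: "0 \<le> r" using assms by linarith
  have "m\<^sup>2 - x\<^sup>2 = (m - \<bar>x\<bar>) * (m + \<bar>x\<bar>)"
    by (simp add: algebra_simps power2_eq_square)
  also have "\<dots> \<le> r * (m + \<bar>x\<bar>)"
    using \<open>m - \<bar>x\<bar> \<le> r\<close> by (intro mult_right_mono) (auto simp: m_def)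
  also have "\<dots> \<le> r * 4"
    using True r by (intro mult_left_mono) (auto simp: m_def)
  finally have "m\<^sup>2 - x\<^sup>2 \<le> 4 * r" by simp
  moreover have "max (4 - x0\<^sup>2) 0 = 4 - m\<^sup>2"
  proof (cases "\<bar>x0\<bar> \<le> 2")
    case True
    then have "x0\<^sup>2 \<le> 4" using abs_le_square_iff[of x0 2] by simp
    then show ?thesis using True by (simp add: m_def min_def)
  next
    case False
    then have "x0\<^sup>2 \<ge> 4" using abs_le_square_iff[of 2 x0] by simp
    then show ?thesis using False by (simp add: m_def min_def)
  qed
  ultimately show ?thesis using r by auto
next
  case False
  then have "x\<^sup>2 \<ge> 4" using abs_le_square_iff[of 2 x] by simp
  then show ?thesis using assms by auto
qed

text \<open>This is the exponent per unit of \<open>n\<close> that real \<open>u\<close> gives in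
  \<open>weighted_poly_joukowski_bound\<close>. With \<open>L = ln (1 / a\<^sup>2)\<close> it equals
  \<open>(L - sinh L) / 2\<close>, hence is nonpositive. For small \<open>a\<close> the term
  \<open>1 / (4 * a\<^sup>2)\<close> beats every power of \<open>1 / a\<close>; the factor
  \<open>a\<^sup>2\<close> kept here later becomes the decay in \<open>x0\<close>.\<close>

lemma joukowski_decay:
  fixes a :: real
  assumes "0 < a" "a \<le> 1"
  shows "ln (1 / a) - (1 / a\<^sup>2 - a\<^sup>2) / 4 \<le> 0"
    and "exp (ln (1 / a) - (1 / a\<^sup>2 - a\<^sup>2) / 4) \<le> 64 * a\<^sup>2"
proof -
  define L where "L = ln (1 / a\<^sup>2)"
  have "a\<^sup>2 \<le> 1" using assms by (simp add: power_le_one)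
  then have "0 \<le> L" using assms by (simp add: L_def)
  moreover have "exp L = 1 / a\<^sup>2"
    using assms by (simp add: L_def del: ln_div ln_divide_pos)
  moreover have "L = 2 * ln (1 / a)"
    using assms by (simp add: L_def ln_div ln_realpow)
  ultimately show "ln (1 / a) - (1 / a\<^sup>2 - a\<^sup>2) / 4 \<le> 0"
    using real_le_x_sinh[of L] by simp
  define q where "q = 1 / (4 * a\<^sup>2)"
  have q: "q \<ge> 0" by (simp add: q_def)
  have "exp q \<ge> q\<^sup>2 / 2"
    using exp_lower_Taylor_quadratic[OF q] q by linarith
  moreover have "q\<^sup>2 / 2 > 0" using assms by (simp add: q_def)
  ultimately have "inverse (exp q) \<le> inverse (q\<^sup>2 / 2)"
    by (intro le_imp_inverse_le)
  then have e: "exp (- q) \<le> 32 * a ^ 4"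
    using assms by (simp add: exp_minus q_def field_simps power2_eq_square power4_eq_xxxx)
  have "a\<^sup>2 \<le> 1" using assms by (simp add: power_le_one)
  then have "exp (a\<^sup>2 / 4) \<le> exp (1 / 2 * ln 2)"
    using ln2_ge_two_thirds by simp
  also have "\<dots> \<le> exp (ln 2)" by (subst exp_le_cancel_iff) auto
  finally have e2: "exp (a\<^sup>2 / 4) \<le> 2" by simp
  have "exp (ln (1 / a) - (1 / a\<^sup>2 - a\<^sup>2) / 4) = exp (ln (1 / a)) * exp (- q) * exp (a\<^sup>2 / 4)"
    by (simp add: q_def exp_add[symmetric] field_simps)
  also have "\<dots> = (1 / a) * exp (- q) * exp (a\<^sup>2 / 4)" using assms by simp
  also have "\<dots> \<le> (1 / a) * (32 * a ^ 4) * 2"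
    using e e2 assms by (intro mult_mono) auto
  also have "\<dots> = 64 * a\<^sup>2 * a"
    using assms by (simp add: field_simps power2_eq_square power4_eq_xxxx)
  also have "\<dots> \<le> 64 * a\<^sup>2 * 1" using assms by (intro mult_left_mono) auto
  finally show "exp (ln (1 / a) - (1 / a\<^sup>2 - a\<^sup>2) / 4) \<le> 64 * a\<^sup>2" by simp
qed

section \<open>Weighted polynomials and the maximum principle\<close>

text \<open>For real \<open>z\<close> the power \<open>\<beta>\<close> of the modulus has Gaussian
  factor \<open>exp (- n * \<beta> * z\<^sup>2 / 4)\<close>, that of one coordinate in
  \<open>gbe_weight\<close>. The argument is complex so that the maximum principle and Cauchy's
  estimate apply.\<close>

definition weighted_poly :: "nat \<Rightarrow> nat set \<Rightarrow> (nat \<Rightarrow> real) \<Rightarrow> complex \<Rightarrow> complex" where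
  "weighted_poly n A x z = (\<Prod>k\<in>A. z - of_real (x k)) * exp (- (of_nat n * z\<^sup>2 / 4))"

lemma weighted_poly_holomorphic [holomorphic_intros]: "weighted_poly n A x holomorphic_on S"
  unfolding weighted_poly_def by (intro holomorphic_intros) auto

text \<open>The Joukowski map sends the unit circle to [-2, 2], where \<open>M\<close> is a bound.
  The pulled-back function is singular at 0; extra factors of modulus 1 on the circle repair this,
  the maximum principle applies, and dividing by these factors at \<open>u\<close> leaves the
  exponential.\<close>

lemma weighted_poly_joukowski_bound:
  assumes A: "finite A" "card A \<le> n"
    and M: "\<And>t. \<bar>t\<bar> \<le> 2 \<Longrightarrow> norm (weighted_poly n A x (of_real t)) \<le> M"
    and u: "u \<noteq> 0" "norm u \<le> 1"
  shows "norm (weighted_poly n A x (u + 1 / u))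
      \<le> M * exp (real n * (ln (1 / norm u) + Re (u\<^sup>2 - 1 / u\<^sup>2) / 4))"
proof -
  define G where "G = (\<lambda>v::complex. v ^ (n - card A) * (\<Prod>k\<in>A. v\<^sup>2 + 1 - of_real (x k) * v)
      * exp (- (of_nat n * (1 + v\<^sup>2) / 2)))"
  \<comment> \<open>The factor \<open>v ^ n\<close> clears the poles of \<open>v + 1 / v\<close>, and since \<open>(v + 1 / v)\<^sup>2 / 4 = (v\<^sup>2 + 2 + 1 / v\<^sup>2) / 4\<close>
    the last one has modulus 1 on the unit circle and replaces the singular \<open>1 / v\<^sup>2\<close> by \<open>v\<^sup>2\<close>.\<close>
  have G: "G v = weighted_poly n A x (v + 1 / v) * v ^ n * exp (of_nat n * (1 / v\<^sup>2 - v\<^sup>2) / 4)"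
    if "v \<noteq> 0" for v
  proof -
    have "(\<Prod>k\<in>A. v\<^sup>2 + 1 - of_real (x k) * v) = (\<Prod>k\<in>A. v * (v + 1 / v - of_real (x k)))"
      using that by (intro prod.cong) (auto simp: field_simps power2_eq_square)
    also have "\<dots> = v ^ card A * (\<Prod>k\<in>A. v + 1 / v - of_real (x k))"
      by (simp add: prod.distrib)
    finally have p: "v ^ (n - card A) * (\<Prod>k\<in>A. v\<^sup>2 + 1 - of_real (x k) * v)
        = v ^ n * (\<Prod>k\<in>A. v + 1 / v - of_real (x k))"
      using A by (simp add: power_add[symmetric] mult.assoc[symmetric])
    have e: "- (of_nat n * (1 + v\<^sup>2) / 2)
        = - (of_nat n * (v + 1 / v)\<^sup>2 / 4) + of_nat n * (1 / v\<^sup>2 - v\<^sup>2) / 4"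
      using that by (simp add: field_simps power2_eq_square)
    show ?thesis
      unfolding G_def weighted_poly_def p e exp_add by (simp add: mult_ac)
  qed
  have "norm (G u) \<le> M"
  proof (rule maximum_modulus_frontier[of G "cball 0 1"])
    show "G holomorphic_on interior (cball 0 1)"
      unfolding G_def by (intro holomorphic_intros) auto
    show "continuous_on (closure (cball 0 1)) G"
      unfolding G_def by (intro continuous_intros) auto
    fix v :: complex assume "v \<in> frontier (cball 0 1)"
    then have v: "norm v = 1" by (simp add: frontier_cball)
    then have v0: "v \<noteq> 0" by auto
    \<comment> \<open>On the circle inversion is conjugation, so \<open>v + 1 / v = 2 * Re v\<close>
      lies in [-2, 2] and \<open>1 / v\<^sup>2 - v\<^sup>2\<close> is purely imaginary.\<close>
    have inv: "1 / v = cnj v"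
      using complex_norm_square[of v] v v0 by (simp add: field_simps)
    have "1 / v\<^sup>2 = cnj (v\<^sup>2)"
      using inv by (metis complex_cnj_power power_one_over)
    then have "Re (1 / v\<^sup>2 - v\<^sup>2) = 0"
      by (simp del: complex_cnj_power)
    then have "Re (of_nat n * (1 / v\<^sup>2 - v\<^sup>2) / 4) = 0"
      by (simp add: mult.commute)
    then have e1: "norm (exp (of_nat n * (1 / v\<^sup>2 - v\<^sup>2) / 4)) = 1"
      unfolding norm_exp_eq_Re by simp
    have "v + 1 / v = of_real (2 * Re v)"
      unfolding inv by (simp add: complex_add_cnj)
    moreover have "\<bar>2 * Re v\<bar> \<le> 2"
      using abs_Re_le_cmod[of v] v by simp
    ultimately show "norm (G v) \<le> M"
      unfolding G[OF v0] norm_mult norm_power v e1 using M[of "2 * Re v"] by simp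
  qed (use u in auto)
  then have "norm (weighted_poly n A x (u + 1 / u)) * (norm u ^ n
      * exp (real n * Re (1 / u\<^sup>2 - u\<^sup>2) / 4)) \<le> M"
    using G[OF u(1)] by (simp add: norm_mult norm_power mult.assoc)
  moreover have "norm u ^ n = exp (- (real n * ln (1 / norm u)))"
    using u by (simp add: ln_div exp_of_nat_mult)
  ultimately have "norm (weighted_poly n A x (u + 1 / u))
      * exp (- (real n * (ln (1 / norm u) + Re (u\<^sup>2 - 1 / u\<^sup>2) / 4))) \<le> M"
    by (simp add: exp_add[symmetric] algebra_simps diff_divide_distrib)
  then show ?thesis
    by (simp add: exp_minus field_simps)
qed

lemma semicircle_trunc_bounds:
  assumes "n \<ge> 1"
  shows "real n powr (- (1/3)) \<le> semicircle_trunc n x" "0 < semicircle_trunc n x"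
    "semicircle_trunc n x \<le> 1" "max (4 - x\<^sup>2) 0 \<le> 4 * (pi * semicircle_trunc n x)\<^sup>2"
proof -
  show 1: "real n powr (- (1/3)) \<le> semicircle_trunc n x"
    by (simp add: semicircle_trunc_def)
  have "0 < real n powr (- (1/3))" using assms by simp
  then show "0 < semicircle_trunc n x" using 1 by linarith
  have "sqrt (max (4 - x\<^sup>2) 0) \<le> 2"
    by (rule real_le_lsqrt) auto
  then have "semicircle x \<le> 1 / (2 * pi) * 2"
    unfolding semicircle_def by (intro mult_left_mono) auto
  also have "\<dots> \<le> 1" using pi_gt3 by simp
  finally have "semicircle x \<le> 1" .
  moreover have "real n powr (- (1/3)) \<le> 1"
    using assms by (simp add: powr_minus powr_le1 ge_one_powr_ge_zero inverse_le_1_iff)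
  ultimately show "semicircle_trunc n x \<le> 1" by (simp add: semicircle_trunc_def)
  have "0 \<le> semicircle x" by (simp add: semicircle_def)
  then have "(semicircle x)\<^sup>2 \<le> (semicircle_trunc n x)\<^sup>2"
    by (intro power_mono) (simp_all add: semicircle_trunc_def)
  moreover have "(semicircle x)\<^sup>2 = max (4 - x\<^sup>2) 0 / (4 * pi\<^sup>2)"
    by (simp add: semicircle_def power_mult_distrib power_divide)
  ultimately show "max (4 - x\<^sup>2) 0 \<le> 4 * (pi * semicircle_trunc n x)\<^sup>2"
    by (simp add: field_simps power_mult_distrib)
qed

text \<open>Here \<open>960 = 64 * 15\<close>, with 64 from \<open>joukowski_decay\<close> and 15
  from comparing \<open>a\<^sup>2\<close> with \<open>1 / (1 + x0\<^sup>2)\<close>;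
  \<open>exp 4\<close> bounds the contribution of the argument of \<open>u\<close>.\<close>

definition disc_const :: real where
  "disc_const = 960 * exp 4"

lemma disc_const_ge_1: "1 \<le> disc_const"
  unfolding disc_const_def using exp_ge_add_one_self[of "4::real"] by linarith

text \<open>The radius is the local spacing scale. With \<open>z = u + 1 / u\<close> and
  \<open>u = a * (b + \<i> * s)\<close>, the exponent is \<open>n\<close> times
  \<open>\<psi> + (1 / a\<^sup>2 - a\<^sup>2) * s\<^sup>2 / 2\<close>. On the disc the second
  summand is at most \<open>4 / n\<close>, while \<open>\<psi>\<close> supplies the decay in
  \<open>x0\<close>.\<close>

lemma weighted_poly_disc_bound:
  assumes A: "finite A" "card A \<le> n" and n: "n \<ge> 1"
    and M: "\<And>t. \<bar>t\<bar> \<le> 2 \<Longrightarrow> norm (weighted_poly n A x (of_real t)) \<le> M"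
    and z: "norm (z - of_real x0) \<le> 1 / (real n * semicircle_trunc n x0)"
  shows "norm (weighted_poly n A x z) \<le> disc_const * M / (1 + x0\<^sup>2)"
proof -
  have M0: "0 \<le> M" by (rule order_trans[OF norm_ge_zero M[of 0]]) simp
  define \<sigma> where "\<sigma> = semicircle_trunc n x0"
  define r where "r = 1 / (real n * \<sigma>)"
  note \<sigma> = semicircle_trunc_bounds[OF n, of x0, folded \<sigma>_def]
  have np: "real n \<ge> 1" using n by simp
  define c where "c = real n powr (- (1/3))"
  have c: "0 < c" "c \<le> \<sigma>" using np \<sigma>(1) by (auto simp: c_def)
  have c3: "1 / real n = c ^ 3"
    using np by (simp add: c_def powr_power powr_minus field_simps)
  have r: "0 < r" using np \<sigma>(2) by (simp add: r_def)
  \<comment> \<open>The truncation at \<open>n powr (- (1/3))\<close> enters here: it gives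
    \<open>1 / n \<le> \<sigma> ^ 3\<close>, so moving by \<open>r\<close> changes
    \<open>4 - x\<^sup>2\<close> by at most the order of \<open>\<sigma>\<^sup>2\<close>.\<close>
  have r\<sigma>: "r \<le> \<sigma>\<^sup>2"
  proof -
    have "r = c ^ 3 / \<sigma>" by (simp add: r_def c3[symmetric])
    also have "\<dots> \<le> \<sigma> ^ 3 / \<sigma>"
      using c \<sigma>(2) by (intro divide_right_mono power_mono) auto
    also have "\<dots> = \<sigma>\<^sup>2" using \<sigma>(2) by (simp add: power2_eq_square power3_eq_cube)
    finally show ?thesis .
  qed
  have r1: "r \<le> 1" using r\<sigma> \<sigma>(2,3) by (meson order_trans power_le_one less_imp_le)
  obtain u where u: "u \<noteq> 0" "norm u \<le> 1" "z = u + 1 / u"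
    by (rule joukowski_preimage)
  define a where "a = norm u"
  have a: "0 < a" "a \<le> 1" using u by (auto simp: a_def)
  \<comment> \<open>\<open>b\<close> and \<open>s\<close> are the cosine and sine of the argument of
    \<open>u\<close>.\<close>
  define b where "b = Re u / a"
  define s where "s = Im u / a"
  have Re_u: "Re u = a * b" and Im_u: "Im u = a * s" using a by (auto simp: b_def s_def)
  have "(Re u)\<^sup>2 + (Im u)\<^sup>2 = a\<^sup>2" by (simp add: a_def cmod_power2)
  then have "a\<^sup>2 * (b\<^sup>2 + s\<^sup>2) = a\<^sup>2" by (simp add: Re_u Im_u power_mult_distrib algebra_simps)
  then have bs: "b\<^sup>2 + s\<^sup>2 = 1" using a by simp
  have inv: "1 / u = cnj u / of_real (a\<^sup>2)"
    using complex_norm_square[of u] u(1) by (simp add: a_def field_simps)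
  define X where "X = Re z"
  define Y where "Y = Im z"
  have Re_inv: "Re (1 / u) = b / a" and Im_inv: "Im (1 / u) = - s / a"
    unfolding inv using a by (simp_all add: Re_u Im_u power2_eq_square)
  have X: "X = (1 / a + a) * b" and Y: "Y = - ((1 / a - a) * s)"
    unfolding X_def Y_def u(3) plus_complex.sel Re_inv Im_inv Re_u Im_u
    by (simp_all add: algebra_simps)
  have XY: "\<bar>X - x0\<bar> \<le> r" "\<bar>Y\<bar> \<le> r"
    using z abs_Re_le_cmod[of "z - of_real x0"] abs_Im_le_cmod[of "z - of_real x0"]
    by (simp_all add: X_def Y_def r_def \<sigma>_def)
  have Re2: "Re (u\<^sup>2 - 1 / u\<^sup>2) = - ((1 / a\<^sup>2 - a\<^sup>2) * (1 - 2 * s\<^sup>2))"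
  proof -
    have "Re (u\<^sup>2 - 1 / u\<^sup>2) = Re (u\<^sup>2) - Re ((1 / u)\<^sup>2)" by (simp add: power_one_over)
    also have "\<dots> = (a * b)\<^sup>2 - (a * s)\<^sup>2 - ((b / a)\<^sup>2 - (s / a)\<^sup>2)"
      unfolding power2_eq_square[of u] power2_eq_square[of "1 / u"] times_complex.sel
        Re_inv Im_inv Re_u Im_u by (simp add: power2_eq_square)
    also have "\<dots> = - ((1 / a\<^sup>2 - a\<^sup>2) * (b\<^sup>2 - s\<^sup>2))"
      using a by (simp add: field_simps)
    also have "b\<^sup>2 - s\<^sup>2 = 1 - 2 * s\<^sup>2" using bs by simp
    finally show ?thesis .
  qed
  \<comment> \<open>\<open>\<bar>Y\<bar> * B\<close> is the part of the exponent that is positive, and \<open>B = O(\<sigma>)\<close> near \<open>x0\<close>.\<close>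
  define B where "B = \<bar>s\<bar> * (1 / a + a) / 2"
  have B0: "0 \<le> B" using a by (simp add: B_def)
  define q where "q = (1 / a - a)\<^sup>2"
  have q4: "(1 / a + a)\<^sup>2 = q + 4" using a by (simp add: q_def power2_eq_square field_simps)
  have Y2: "Y\<^sup>2 = q * s\<^sup>2" by (simp add: Y q_def power_mult_distrib)
  have b2: "1 - s\<^sup>2 = b\<^sup>2" using bs by simp
  \<comment> \<open>The bound holds in terms of \<open>X\<close>; the edge Lipschitz estimate moves
    it to \<open>x0\<close>, where the semicircle density turns it into
    \<open>(pi * \<sigma>)\<^sup>2\<close>.\<close>
  have "s\<^sup>2 \<le> max (4 - X\<^sup>2) 0 / 4 + \<bar>Y\<bar>"
  proof (rule joukowski_sin_bound)
    show "X\<^sup>2 = (q + 4) * (1 - s\<^sup>2)"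
      unfolding X power_mult_distrib q4 b2 ..
  qed (auto simp: q_def Y2[unfolded q_def])
  also have "\<dots> \<le> (max (4 - x0\<^sup>2) 0 + 4 * r) / 4 + r"
    using semicircle_edge_lipschitz[OF XY(1)] XY(2) by (intro add_mono divide_right_mono) auto
  also have "\<dots> \<le> (4 * (pi * \<sigma>)\<^sup>2 + 4 * r) / 4 + r"
    using \<sigma>(4) by (intro add_mono divide_right_mono) auto
  also have "\<dots> = (pi * \<sigma>)\<^sup>2 + 2 * r" by simp
  finally have "s\<^sup>2 \<le> (pi * \<sigma>)\<^sup>2 + 2 * r" .
  moreover have "B\<^sup>2 = s\<^sup>2 + Y\<^sup>2 / 4"
  proof -
    have "B\<^sup>2 = s\<^sup>2 * (1 / a + a)\<^sup>2 / 4" by (simp add: B_def power_mult_distrib power_divide)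
    then show ?thesis unfolding q4 Y2 by (simp add: algebra_simps)
  qed
  moreover have "Y\<^sup>2 \<le> r"
  proof -
    have "Y\<^sup>2 = \<bar>Y\<bar> * \<bar>Y\<bar>" by (simp add: power2_eq_square)
    also have "\<dots> \<le> r * 1" using XY(2) r r1 by (intro mult_mono) auto
    finally show ?thesis by simp
  qed
  moreover have "(pi * \<sigma>)\<^sup>2 \<le> 13 * \<sigma>\<^sup>2"
    unfolding power_mult_distrib
  proof (intro mult_right_mono)
    have "pi\<^sup>2 \<le> (16/5)\<^sup>2" using pi_approx by (intro power_mono) auto
    then show "pi\<^sup>2 \<le> 13" by (simp add: power2_eq_square)
  qed auto
  moreover have "(4 * \<sigma>)\<^sup>2 = 16 * \<sigma>\<^sup>2" by (simp add: power_mult_distrib)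
  \<comment> \<open>The total is at most \<open>13 * \<sigma>\<^sup>2 + 2 * r + r / 4\<close>, which
    is below \<open>16 * \<sigma>\<^sup>2\<close> because
    \<open>r \<le> \<sigma>\<^sup>2\<close>.\<close>
  ultimately have "B\<^sup>2 \<le> (4 * \<sigma>)\<^sup>2"
    using r\<sigma> zero_le_power2[of \<sigma>] by linarith
  then have B: "B \<le> 4 * \<sigma>"
    using \<sigma>(2) by (intro power2_le_imp_le[of B]) auto
  \<comment> \<open>Factoring \<open>1 / a\<^sup>2 - a\<^sup>2\<close> and giving each factor one
    \<open>\<bar>s\<bar>\<close> produces \<open>\<bar>Y\<bar> * B\<close>; then
    \<open>r * \<sigma> = 1 / n\<close> cancels \<open>n\<close>.\<close>
  have tilt: "real n * ((1 / a\<^sup>2 - a\<^sup>2) * s\<^sup>2 / 2) \<le> 4"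
  proof -
    have "1 \<le> 1 / a" using a by simp
    then have absY: "\<bar>Y\<bar> = (1 / a - a) * \<bar>s\<bar>" using a(2) by (simp add: Y abs_mult)
    have "1 / a\<^sup>2 - a\<^sup>2 = (1 / a - a) * (1 / a + a)"
      by (simp add: power2_eq_square algebra_simps)
    moreover have "s\<^sup>2 = \<bar>s\<bar> * \<bar>s\<bar>" by (simp add: power2_eq_square)
    ultimately have "(1 / a\<^sup>2 - a\<^sup>2) * s\<^sup>2 / 2 = \<bar>Y\<bar> * B"
      unfolding absY B_def by (simp only: mult_ac times_divide_eq_left times_divide_eq_right)
    also have "\<dots> \<le> r * (4 * \<sigma>)" using XY(2) B B0 r by (intro mult_mono) auto
    also have "\<dots> = 4 / real n" using \<sigma>(2) by (simp add: r_def)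
    finally show ?thesis using np by (simp add: field_simps)
  qed
  define \<psi> where "\<psi> = ln (1 / a) - (1 / a\<^sup>2 - a\<^sup>2) / 4"
  have \<psi>: "\<psi> \<le> 0" "exp \<psi> \<le> 64 * a\<^sup>2"
    using joukowski_decay[OF a] by (auto simp: \<psi>_def)
  have "ln (1 / a) + Re (u\<^sup>2 - 1 / u\<^sup>2) / 4 = \<psi> + (1 / a\<^sup>2 - a\<^sup>2) * s\<^sup>2 / 2"
    unfolding Re2 \<psi>_def by (simp add: algebra_simps add_divide_distrib diff_divide_distrib)
  then have "real n * (ln (1 / a) + Re (u\<^sup>2 - 1 / u\<^sup>2) / 4)
      = real n * \<psi> + real n * ((1 / a\<^sup>2 - a\<^sup>2) * s\<^sup>2 / 2)"
    by (simp add: distrib_left)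
  \<comment> \<open>As \<open>\<psi> \<le> 0\<close> and \<open>n \<ge> 1\<close>, a single copy of
    \<open>\<psi>\<close> is kept, which makes the decay uniform in \<open>n\<close>.\<close>
  also have "\<dots> \<le> \<psi> + 4"
    using tilt np \<psi>(1) mult_right_mono_neg[of 1 "real n" \<psi>] by linarith
  finally have "norm (weighted_poly n A x z) \<le> M * exp (\<psi> + 4)"
    using weighted_poly_joukowski_bound[OF A M u(1,2)] M0 unfolding u(3) a_def
    by (meson exp_le_cancel_iff mult_left_mono order_trans)
  also have "\<dots> \<le> M * (64 * a\<^sup>2 * exp 4)"
    unfolding exp_add using \<psi>(2) M0 by (intro mult_left_mono mult_right_mono) auto
  \<comment> \<open>The constant is \<open>3 * 5\<close>: passing from \<open>x0\<close> to
    \<open>X\<close> costs 3, and \<open>a * \<bar>X\<bar> \<le> 1 + a\<^sup>2 \<le> 2\<close> gives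
    \<open>a\<^sup>2 * (1 + X\<^sup>2) \<le> 5\<close>.\<close>
  also have "\<dots> \<le> M * (64 * (15 / (1 + x0\<^sup>2)) * exp 4)"
  proof -
    have "(1 + x0\<^sup>2) \<le> 3 * (1 + X\<^sup>2)"
    proof -
      have "(x0 - X)\<^sup>2 \<le> 1" using XY(1) r1 abs_square_le_1[of "x0 - X"] by simp
      moreover have "x0\<^sup>2 \<le> 2 * X\<^sup>2 + 2 * (x0 - X)\<^sup>2"
        using zero_le_power2[of "2 * X - x0"] by (simp add: power2_eq_square algebra_simps)
      ultimately show ?thesis
        unfolding distrib_left using zero_le_power2[of X] by linarith
    qed
    moreover have "a\<^sup>2 * (1 + X\<^sup>2) \<le> 5"
    proof -
      have "a * \<bar>X\<bar> = (1 + a\<^sup>2) * \<bar>b\<bar>"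
      proof -
        have "\<bar>X\<bar> = (1 / a + a) * \<bar>b\<bar>"
          unfolding X abs_mult using a by (simp add: abs_of_pos)
        moreover have "a * (1 / a + a) = 1 + a\<^sup>2"
          using a by (simp add: power2_eq_square distrib_left)
        ultimately show ?thesis by (simp only: mult.assoc[symmetric])
      qed
      also have "\<dots> \<le> (1 + 1) * 1"
      proof (intro mult_mono add_mono)
        show "\<bar>b\<bar> \<le> 1" using bs zero_le_power2[of s] abs_square_le_1[of b] by linarith
      qed (use a in \<open>auto simp: power_le_one\<close>)
      finally have "(a * \<bar>X\<bar>)\<^sup>2 \<le> 2\<^sup>2" using a by (intro power_mono) auto
      moreover have "a\<^sup>2 \<le> 1" using a by (simp add: power_le_one)
      ultimately show ?thesis by (simp add: power_mult_distrib distrib_left)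
    qed
    moreover have "a\<^sup>2 * (1 + x0\<^sup>2) \<le> a\<^sup>2 * (3 * (1 + X\<^sup>2))"
      using calculation(1) by (intro mult_left_mono) auto
    moreover have "a\<^sup>2 * (3 * (1 + X\<^sup>2)) = 3 * (a\<^sup>2 * (1 + X\<^sup>2))"
      by (rule mult.left_commute)
    ultimately have "a\<^sup>2 * (1 + x0\<^sup>2) \<le> 15" by linarith
    then have "a\<^sup>2 \<le> 15 / (1 + x0\<^sup>2)"
      by (simp add: pos_le_divide_eq add_pos_nonneg)
    then show ?thesis using M0 by (intro mult_left_mono mult_right_mono) auto
  qed
  finally show ?thesis by (simp add: disc_const_def mult_ac)
qed

section \<open>Local Lipschitz bounds and their consequences\<close>

text \<open>Circles of radius \<open>r / 2\<close> about points of the half-size disc stay in the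
  full disc, so Cauchy's estimate bounds the derivative by \<open>2 * B / r\<close>.\<close>

lemma entire_lipschitz:
  fixes f :: "complex \<Rightarrow> complex"
  assumes f: "f holomorphic_on UNIV" and r: "0 < r"
    and B: "\<And>w. norm (w - z0) \<le> r \<Longrightarrow> norm (f w) \<le> B"
    and z: "norm (z - z0) \<le> r / 2"
  shows "norm (f z - f z0) \<le> 2 * B / r * norm (z - z0)"
proof (rule field_differentiable_bound[of "cball z0 (r / 2)" f "deriv f"])
  fix w assume w: "w \<in> cball z0 (r / 2)"
  show "(f has_field_derivative deriv f w) (at w within cball z0 (r / 2))"
    using f holomorphic_derivI[of f UNIV w] by (simp add: has_field_derivative_at_within)
  have "norm ((deriv ^^ 1) f w) \<le> fact 1 * B / (r / 2) ^ 1"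
  proof (rule Cauchy_inequality)
    show "f holomorphic_on ball w (r / 2)" using f holomorphic_on_subset by blast
    show "continuous_on (cball w (r / 2)) f"
      using f holomorphic_on_imp_continuous_on continuous_on_subset by blast
    fix v assume v: "norm (w - v) = r / 2"
    have "norm (v - z0) \<le> norm (w - z0) + norm (w - v)"
      using norm_triangle_ineq[of "w - z0" "v - w"] by (simp add: norm_minus_commute)
    also have "\<dots> \<le> r" using w v by (simp add: dist_norm norm_minus_commute)
    finally show "norm (f v) \<le> B" by (rule B)
  qed (use r in auto)
  then show "norm (deriv f w) \<le> 2 * B / r" by (simp add: field_simps)
qed (use z r in \<open>auto simp: dist_norm norm_minus_commute\<close>)

lemma weighted_poly_lipschitz:
  assumes A: "finite A" "card A \<le> n" and n: "n \<ge> 1"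
    and M: "\<And>t. \<bar>t\<bar> \<le> 2 \<Longrightarrow> norm (weighted_poly n A x (of_real t)) \<le> M"
    and y: "real n * semicircle_trunc n x0 * \<bar>y - x0\<bar> \<le> 1 / 2"
  shows "norm (weighted_poly n A x (of_real y) - weighted_poly n A x (of_real x0))
      \<le> 2 * (disc_const * M / (1 + x0\<^sup>2)) * (real n * semicircle_trunc n x0 * \<bar>y - x0\<bar>)"
proof -
  define r where "r = 1 / (real n * semicircle_trunc n x0)"
  have pos: "0 < real n * semicircle_trunc n x0"
    using n semicircle_trunc_bounds(2)[OF n] by simp
  have yx: "norm (complex_of_real y - of_real x0) = \<bar>y - x0\<bar>"
    by (metis norm_of_real of_real_diff)
  have "norm (weighted_poly n A x (of_real y) - weighted_poly n A x (of_real x0))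
      \<le> 2 * (disc_const * M / (1 + x0\<^sup>2)) / r * norm (complex_of_real y - of_real x0)"
  proof (rule entire_lipschitz[OF weighted_poly_holomorphic])
    show "0 < r" using pos by (simp add: r_def)
    show "norm (weighted_poly n A x w) \<le> disc_const * M / (1 + x0\<^sup>2)"
      if "norm (w - of_real x0) \<le> r" for w
      by (rule weighted_poly_disc_bound[OF A n M that[unfolded r_def]])
    show "norm (complex_of_real y - of_real x0) \<le> r / 2"
      unfolding yx r_def using y pos by (simp add: field_simps)
  qed
  then show ?thesis
    unfolding yx by (simp add: r_def mult_ac)
qed

lemma weighted_poly_measurable [measurable]:
  "(\<lambda>t. weighted_poly n A x (of_real t)) \<in> borel_measurable borel"
  unfolding weighted_poly_def by measurable

text \<open>By the Lipschitz bound the modulus stays above half its maximum on an interval of length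
  of order \<open>1 / n\<close> starting at a maximum point in [-2, 2]; integrating over that
  interval gives the claim.\<close>

lemma weighted_poly_sup_le_lp:
  assumes A: "finite A" "card A \<le> n" and n: "n \<ge> 1" and \<beta>: "0 < \<beta>"
  obtains M where "0 \<le> M"
    and "\<And>t. \<bar>t\<bar> \<le> 2 \<Longrightarrow> norm (weighted_poly n A x (of_real t)) \<le> M"
    and "ennreal ((M / 2) powr \<beta> / (4 * disc_const * real n))
      \<le> (\<integral>\<^sup>+t. ennreal (norm (weighted_poly n A x (of_real t)) powr \<beta>) \<partial>lborel)"
proof -
  define F where "F = (\<lambda>t. norm (weighted_poly n A x (of_real t)))"
  have K: "1 \<le> disc_const" by (rule disc_const_ge_1)
  have np: "0 < real n" using n by simp
  have "continuous_on {-2..2} F"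
    unfolding F_def weighted_poly_def by (intro continuous_intros) auto
  then obtain s where s: "s \<in> {-2..2}" "\<And>t. t \<in> {-2..2} \<Longrightarrow> F t \<le> F s"
    using continuous_attains_sup[of "{-2..2::real}" F] by auto
  define M where "M = F s"
  \<comment> \<open>With this length the rescaled distance is at most
    \<open>1 / (4 * disc_const)\<close>, so the Lipschitz bound allows a drop of at most
    \<open>M / 2\<close>.\<close>
  define \<rho> where "\<rho> = 1 / (4 * disc_const * real n)"
  have M0: "0 \<le> M" by (simp add: M_def F_def)
  have \<rho>: "0 < \<rho>" using K np by (simp add: \<rho>_def)
  have M: "F t \<le> M" if "\<bar>t\<bar> \<le> 2" for t
    using s(2)[of t] that by (auto simp: M_def abs_le_iff)
  have lower: "M / 2 \<le> F t" if t: "t \<in> {s..s + \<rho>}" for t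
  proof -
    define d where "d = real n * semicircle_trunc n s * \<bar>t - s\<bar>"
    have \<sigma>: "0 < semicircle_trunc n s" "semicircle_trunc n s \<le> 1"
      using semicircle_trunc_bounds[OF n] by auto
    have "d \<le> real n * 1 * \<rho>"
      unfolding d_def using t \<sigma> np \<rho> by (intro mult_mono) auto
    also have "\<dots> = 1 / (4 * disc_const)" using np by (simp add: \<rho>_def)
    finally have d: "d \<le> 1 / (4 * disc_const)" .
    also have "\<dots> \<le> 1 / 2" using K by simp
    finally have "norm (weighted_poly n A x (of_real t) - weighted_poly n A x (of_real s))
        \<le> 2 * (disc_const * M / (1 + s\<^sup>2)) * d"
      unfolding d_def by (intro weighted_poly_lipschitz A n M[unfolded F_def])
    also have "\<dots> \<le> 2 * (disc_const * M / 1) * (1 / (4 * disc_const))"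
      using d K M0 \<sigma> np
      by (intro mult_mono mult_left_mono divide_left_mono) (auto simp: d_def add_pos_nonneg)
    also have "\<dots> = M / 2" using K by simp
    finally show ?thesis
      unfolding M_def F_def
      using norm_triangle_ineq2[of "weighted_poly n A x (of_real s)" "weighted_poly n A x (of_real t)"]
      by (simp add: norm_minus_commute)
  qed
  have "ennreal ((M / 2) powr \<beta> / (4 * disc_const * real n)) = ennreal ((M / 2) powr \<beta>) * ennreal \<rho>"
    using \<rho> by (simp add: \<rho>_def ennreal_mult[symmetric])
  also have "\<dots> = (\<integral>\<^sup>+t. ennreal ((M / 2) powr \<beta>) * indicator {s..s + \<rho>} t \<partial>lborel)"
    using \<rho> by (simp add: nn_integral_cmult_indicator)
  also have "\<dots> \<le> (\<integral>\<^sup>+t. ennreal (F t powr \<beta>) \<partial>lborel)"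
  proof (intro nn_integral_mono)
    fix t
    show "ennreal ((M / 2) powr \<beta>) * indicator {s..s + \<rho>} t \<le> ennreal (F t powr \<beta>)"
    proof (cases "t \<in> {s..s + \<rho>}")
      case True
      then show ?thesis
        using lower[OF True] M0 \<beta> by (auto intro!: ennreal_leI powr_mono2)
    qed auto
  qed
  finally show thesis
    using that[OF M0] M unfolding F_def by blast
qed

text \<open>The function vanishes at \<open>x k\<close>, so the Lipschitz bound makes it a small
  multiple of \<open>M\<close> at \<open>x0\<close>, and the previous lemma trades \<open>M\<close>
  for the integral at the cost of a factor \<open>n\<close>.\<close>

lemma weighted_poly_near_zero:
  assumes A: "finite A" "card A \<le> n" and n: "n \<ge> 1" and \<beta>: "1 \<le> \<beta>"
    and q: "0 < q" "q \<le> 1" and k: "k \<in> A"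
    and gap: "real n * semicircle_trunc n x0 * \<bar>x0 - x k\<bar> < q / (16 * disc_const\<^sup>2)"
  shows "ennreal (norm (weighted_poly n A x (of_real x0)) powr \<beta> * (1 + x0\<^sup>2))
      \<le> ennreal (q powr \<beta> * real n)
        * (\<integral>\<^sup>+t. ennreal (norm (weighted_poly n A x (of_real t)) powr \<beta>) \<partial>lborel)"
proof -
  define K where "K = disc_const"
  have K: "1 \<le> K" unfolding K_def by (rule disc_const_ge_1)
  have np: "0 < real n" using n by simp
  obtain M where M0: "0 \<le> M"
    and M: "\<And>t. \<bar>t\<bar> \<le> 2 \<Longrightarrow> norm (weighted_poly n A x (of_real t)) \<le> M"
    and int: "ennreal ((M / 2) powr \<beta> / (4 * K * real n))
      \<le> (\<integral>\<^sup>+t. ennreal (norm (weighted_poly n A x (of_real t)) powr \<beta>) \<partial>lborel)"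
    using weighted_poly_sup_le_lp[OF A n, of \<beta> x] \<beta> unfolding K_def by auto
  define d where "d = real n * semicircle_trunc n x0 * \<bar>x k - x0\<bar>"
  define p where "p = 1 + x0\<^sup>2"
  have p: "1 \<le> p" by (simp add: p_def)
  have d: "d \<le> q / (16 * K\<^sup>2)"
    using gap by (simp add: d_def K_def abs_minus_commute)
  also have "\<dots> \<le> 1 / (16 * 1)"
    using q K by (intro frac_le mult_left_mono) (auto simp: one_le_power)
  finally have "d \<le> 1 / 2" by simp
  then have "norm (weighted_poly n A x (of_real (x k)) - weighted_poly n A x (of_real x0))
      \<le> 2 * (K * M / p) * d"
    unfolding d_def K_def p_def by (intro weighted_poly_lipschitz A n M)
  moreover have "weighted_poly n A x (of_real (x k)) = 0"
    using k A by (auto simp: weighted_poly_def prod_zero_iff)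
  ultimately have "norm (weighted_poly n A x (of_real x0)) \<le> 2 * (K * M / p) * d" by simp
  also have "\<dots> \<le> 2 * (K * M / p) * (q / (16 * K\<^sup>2))"
    using d K M0 p by (intro mult_left_mono) auto
  \<comment> \<open>The \<open>16 * disc_const\<^sup>2\<close> in the gap is chosen for this: the
    spare factor \<open>1 / (4 * K * p)\<close> supplies the decay \<open>1 / p\<close> and cancels
    the \<open>4 * K\<close> of the integral bound.\<close>
  also have "\<dots> = (M / 2 * q) * (1 / (4 * K * p))"
    using K p by (simp add: field_simps power2_eq_square)
  finally have "norm (weighted_poly n A x (of_real x0)) powr \<beta>
      \<le> ((M / 2 * q) * (1 / (4 * K * p))) powr \<beta>"
    using \<beta> by (intro powr_mono2) auto
  also have "\<dots> = (M / 2) powr \<beta> * q powr \<beta> * (1 / (4 * K * p)) powr \<beta>"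
    using M0 q K p by (simp only: powr_mult)
  also have "\<dots> \<le> (M / 2) powr \<beta> * q powr \<beta> * (1 / (4 * K * p))"
  proof (intro mult_left_mono)
    have "1 * 1 \<le> 4 * K * p" using K p by (intro mult_mono) auto
    then have "1 / (4 * K * p) \<le> 1" "0 < 1 / (4 * K * p)" by auto
    then show "(1 / (4 * K * p)) powr \<beta> \<le> 1 / (4 * K * p)"
      using \<beta> powr_mono'[of 1 \<beta> "1 / (4 * K * p)"] by simp
  qed auto
  finally have "norm (weighted_poly n A x (of_real x0)) powr \<beta> * p
      \<le> (M / 2) powr \<beta> * q powr \<beta> * (1 / (4 * K * p)) * p"
    using p by (intro mult_right_mono) auto
  also have "\<dots> = (q powr \<beta> * real n) * ((M / 2) powr \<beta> / (4 * K * real n))"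
    using p K np by (simp add: field_simps)
  finally have "ennreal (norm (weighted_poly n A x (of_real x0)) powr \<beta> * p)
      \<le> ennreal (q powr \<beta> * real n) * ennreal ((M / 2) powr \<beta> / (4 * K * real n))"
    using K np by (simp add: ennreal_mult[symmetric] ennreal_leI)
  also have "\<dots> \<le> ennreal (q powr \<beta> * real n)
        * (\<integral>\<^sup>+t. ennreal (norm (weighted_poly n A x (of_real t)) powr \<beta>) \<partial>lborel)"
    by (intro mult_left_mono int) auto
  finally show ?thesis by (simp add: p_def)
qed

subsection \<open>The density in a single coordinate\<close>

lemma gbe_weight_nonneg: "0 \<le> gbe_weight \<beta> n x"
  by (simp add: gbe_weight_def prod_nonneg)

lemma coordinate_borel_measurable:
  "j \<in> {1..n} \<Longrightarrow> (\<lambda>x. x j) \<in> borel_measurable (lebesgue_pow n)"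
  using measurable_component_singleton[of j "{1..n}" "\<lambda>_. lborel :: real measure"] by simp

lemma gbe_weight_measurable [measurable]: "gbe_weight \<beta> n \<in> borel_measurable (lebesgue_pow n)"
  unfolding gbe_weight_def
proof (intro borel_measurable_times borel_measurable_prod)
  fix j k assume "j \<in> {1..n}" "k \<in> {1..<j}"
  then have "j \<in> {1..n}" "k \<in> {1..n}" by auto
  note [measurable] = this[THEN coordinate_borel_measurable]
  show "(\<lambda>x. \<bar>x k - x j\<bar> powr \<beta>) \<in> borel_measurable (lebesgue_pow n)" by measurable
next
  have [measurable]: "(\<lambda>x. \<Sum>j\<in>{1..n}. (1 / 2) * (x j)\<^sup>2) \<in> borel_measurable (lebesgue_pow n)"
    by (intro borel_measurable_sum borel_measurable_times borel_measurable_power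
        borel_measurable_const coordinate_borel_measurable)
  show "(\<lambda>x. exp (- (real n * (\<beta> / 2) * (\<Sum>j\<in>{1..n}. (1 / 2) * (x j)\<^sup>2))))
      \<in> borel_measurable (lebesgue_pow n)" by measurable
qed

lemma semicircle_trunc_measurable [measurable]: "semicircle_trunc n \<in> borel_measurable borel"
  unfolding semicircle_trunc_def semicircle_def by measurable

lemma spacing_measurable [measurable]: "spacing n \<in> borel_measurable (lebesgue_pow n)"
proof -
  let ?P = "{(j, k). j \<in> {1..n} \<and> k \<in> {1..n} \<and> j \<noteq> k}"
  let ?f = "\<lambda>p x. ereal (real n * semicircle_trunc n (x (fst p)) * \<bar>x (fst p) - x (snd p)\<bar>)"
  have "(\<lambda>x. INF p\<in>?P. ?f p x) \<in> borel_measurable (lebesgue_pow n)"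
  proof (rule borel_measurable_INF)
    have "?P \<subseteq> {1..n} \<times> {1..n}" by auto
    then show "countable ?P" by (meson countable_finite finite_SigmaI finite_atLeastAtMost finite_subset)
    fix p assume "p \<in> ?P"
    then have p: "fst p \<in> {1..n}" "snd p \<in> {1..n}" by auto
    note [measurable] = p[THEN coordinate_borel_measurable]
    show "?f p \<in> borel_measurable (lebesgue_pow n)" by measurable
  qed
  then show ?thesis by (simp add: spacing_def[abs_def] case_prod_beta)
qed

text \<open>Each index other than \<open>i\<close> forms exactly one ordered pair with
  \<open>i\<close>; \<open>h\<close> puts the larger index first, and symmetry of \<open>f\<close>
  makes the order irrelevant.\<close>

lemma prod_pairs_split:
  fixes f :: "nat \<Rightarrow> nat \<Rightarrow> 'a::comm_monoid_mult"
  assumes i: "i \<in> {1..n}" and sym: "\<And>j k. f j k = f k j"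
  shows "(\<Prod>j\<in>{1..n}. \<Prod>k\<in>{1..<j}. f k j)
    = (\<Prod>k\<in>{1..n} - {i}. f k i)
      * (\<Prod>(j, k)\<in>{(j, k). j \<in> {1..n} \<and> k \<in> {1..<j} \<and> j \<noteq> i \<and> k \<noteq> i}. f k j)"
proof -
  define P where "P = (SIGMA j:{1..n}. {1..<j})"
  define Q where "Q = {(j, k). j \<in> {1..n} \<and> k \<in> {1..<j} \<and> j \<noteq> i \<and> k \<noteq> i}"
  define h where "h = (\<lambda>k. if k < i then (i, k) else (k, i))"
  have QP: "Q \<subseteq> P" and fin: "finite P" by (auto simp: P_def Q_def)
  have h: "P - Q = h ` ({1..n} - {i})"
  proof
    show "P - Q \<subseteq> h ` ({1..n} - {i})"
    proof
      fix p assume p: "p \<in> P - Q"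
      obtain j k where [simp]: "p = (j, k)" by (cases p)
      have "(j = i \<and> k < i \<and> 1 \<le> k) \<or> (k = i \<and> i < j \<and> j \<le> n)"
        using p by (auto simp: P_def Q_def)
      then show "p \<in> h ` ({1..n} - {i})"
        using i by (auto simp: h_def image_iff)
    qed
    show "h ` ({1..n} - {i}) \<subseteq> P - Q"
      using i by (auto simp: P_def Q_def h_def)
  qed
  have inj: "inj_on h ({1..n} - {i})"
    by (auto simp: inj_on_def h_def split: if_splits)
  have "(\<Prod>j\<in>{1..n}. \<Prod>k\<in>{1..<j}. f k j) = (\<Prod>(j, k)\<in>P. f k j)"
    unfolding P_def by (rule prod.Sigma) auto
  also have "\<dots> = (\<Prod>(j, k)\<in>P - Q. f k j) * (\<Prod>(j, k)\<in>Q. f k j)"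
    by (rule prod.subset_diff[OF QP fin])
  also have "(\<Prod>(j, k)\<in>P - Q. f k j) = (\<Prod>k\<in>{1..n} - {i}. f k i)"
    unfolding h prod.reindex[OF inj] by (intro prod.cong) (auto simp: h_def sym)
  finally show ?thesis unfolding Q_def .
qed

text \<open>\<open>R\<close> collects the pairs avoiding \<open>i\<close> and the Gaussian factors
  of the other coordinates; what remains depends on \<open>t\<close> through the weighted polynomial
  alone.\<close>

lemma gbe_weight_update:
  assumes i: "i \<in> {1..n}"
  obtains R where "0 \<le> R" and "\<And>t. gbe_weight \<beta> n (x(i := t))
      = R * norm (weighted_poly n ({1..n} - {i}) x (of_real t)) powr \<beta>"
proof -
  define A where "A = {1..n} - {i}"
  define Q where "Q = {(j, k). j \<in> {1..n} \<and> k \<in> {1..<j} \<and> j \<noteq> i \<and> k \<noteq> i}"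
  define R where "R = (\<Prod>(j, k)\<in>Q. \<bar>x k - x j\<bar> powr \<beta>)
    * exp (- (real n * (\<beta> / 2) * (\<Sum>j\<in>A. (1 / 2) * (x j)\<^sup>2)))"
  have "gbe_weight \<beta> n (x(i := t)) = R * norm (weighted_poly n A x (of_real t)) powr \<beta>" for t
  proof -
    define y where "y = x(i := t)"
    have "(\<Prod>j\<in>{1..n}. \<Prod>k\<in>{1..<j}. \<bar>y k - y j\<bar> powr \<beta>)
        = (\<Prod>k\<in>A. \<bar>y k - y i\<bar> powr \<beta>) * (\<Prod>(j, k)\<in>Q. \<bar>y k - y j\<bar> powr \<beta>)"
      unfolding A_def Q_def using i
      by (intro prod_pairs_split) (auto simp: abs_minus_commute)
    also have "(\<Prod>k\<in>A. \<bar>y k - y i\<bar> powr \<beta>) = (\<Prod>k\<in>A. \<bar>t - x k\<bar> powr \<beta>)"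
      by (intro prod.cong) (auto simp: y_def A_def abs_minus_commute)
    also have "(\<Prod>(j, k)\<in>Q. \<bar>y k - y j\<bar> powr \<beta>) = (\<Prod>(j, k)\<in>Q. \<bar>x k - x j\<bar> powr \<beta>)"
      by (intro prod.cong) (auto simp: y_def Q_def)
    finally have 1: "(\<Prod>j\<in>{1..n}. \<Prod>k\<in>{1..<j}. \<bar>y k - y j\<bar> powr \<beta>)
        = (\<Prod>k\<in>A. \<bar>t - x k\<bar> powr \<beta>) * (\<Prod>(j, k)\<in>Q. \<bar>x k - x j\<bar> powr \<beta>)" .
    have "(\<Sum>j\<in>{1..n}. (1 / 2) * (y j)\<^sup>2) = (1 / 2) * (y i)\<^sup>2 + (\<Sum>j\<in>A. (1 / 2) * (y j)\<^sup>2)"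
      unfolding A_def using i by (intro sum.remove) auto
    also have "(\<Sum>j\<in>A. (1 / 2) * (y j)\<^sup>2) = (\<Sum>j\<in>A. (1 / 2) * (x j)\<^sup>2)"
      by (intro sum.cong) (auto simp: y_def A_def)
    finally have 2: "(\<Sum>j\<in>{1..n}. (1 / 2) * (y j)\<^sup>2)
        = (1 / 2) * t\<^sup>2 + (\<Sum>j\<in>A. (1 / 2) * (x j)\<^sup>2)" by (simp add: y_def)
    have "norm (weighted_poly n A x (of_real t)) = (\<Prod>k\<in>A. \<bar>t - x k\<bar>) * exp (- (real n * t\<^sup>2 / 4))"
    proof -
      have "norm (complex_of_real t - of_real (x k)) = \<bar>t - x k\<bar>" for k
        by (metis norm_of_real of_real_diff)
      moreover have "Re (- (of_nat n * (complex_of_real t)\<^sup>2 / 4)) = - (real n * t\<^sup>2 / 4)"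
        by (simp add: of_real_power[symmetric] del: of_real_power)
      ultimately show ?thesis
        unfolding weighted_poly_def norm_mult norm_exp_eq_Re by (simp add: prod_norm[symmetric])
    qed
    then have 3: "norm (weighted_poly n A x (of_real t)) powr \<beta>
        = (\<Prod>k\<in>A. \<bar>t - x k\<bar> powr \<beta>) * exp (- (real n * t\<^sup>2 / 4) * \<beta>)"
      by (simp add: powr_mult prod_nonneg prod_powr_distrib exp_powr_real)
    have 4: "exp (- (real n * (\<beta> / 2) * ((1 / 2) * t\<^sup>2 + s)))
        = exp (- (real n * t\<^sup>2 / 4) * \<beta>) * exp (- (real n * (\<beta> / 2) * s))" for s
      by (simp add: exp_add[symmetric] algebra_simps)
    show ?thesis
      unfolding y_def[symmetric] gbe_weight_def 1 2 3 4 R_def by (simp only: mult_ac)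
  qed
  moreover have "0 \<le> R" by (auto simp: R_def intro!: mult_nonneg_nonneg prod_nonneg)
  ultimately show thesis using that[of R] unfolding A_def by simp
qed

text \<open>For a close pair \<open>i\<close>, \<open>k\<close>, freeze every coordinate except
  \<open>i\<close>: the weight is then a power of a weighted polynomial with a zero at
  \<open>x k\<close>, close to \<open>x i\<close>.\<close>

lemma spacing_small_imp:
  assumes n: "n \<ge> 1" and \<beta>: "1 \<le> \<beta>" and \<tau>: "0 < \<tau>"
    and sp: "spacing n x < ereal (1 / (16 * disc_const\<^sup>2) * real n powr (- ((2 + \<tau>) / \<beta>)))"
  obtains j where "j \<in> {1..n}"
    and "ennreal (gbe_weight \<beta> n x * (1 + (x j)\<^sup>2))
      \<le> ennreal (real n powr (- (1 + \<tau>))) * (\<integral>\<^sup>+t. ennreal (gbe_weight \<beta> n (x(j := t))) \<partial>lborel)"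
proof -
  define q where "q = real n powr (- ((2 + \<tau>) / \<beta>))"
  have np: "1 \<le> real n" using n by simp
  obtain i k where ik: "i \<in> {1..n}" "k \<in> {1..n}" "i \<noteq> k"
    and gap: "real n * semicircle_trunc n (x i) * \<bar>x i - x k\<bar> < q / (16 * disc_const\<^sup>2)"
    using sp unfolding spacing_def INF_less_iff q_def by auto
  have q: "0 < q" "q \<le> 1"
    using np \<beta> \<tau> powr_mono[of "- ((2 + \<tau>) / \<beta>)" 0 "real n"] by (auto simp: q_def)
  \<comment> \<open>Of the two extra powers of \<open>n\<close> in the threshold, one pays here for
    comparing supremum and integral; the other remains for the sum over coordinates.\<close>
  have "q powr \<beta> * real n = real n powr (- (2 + \<tau>)) * real n powr 1"
    using \<beta> np by (simp add: q_def powr_powr)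
  also have "\<dots> = real n powr (- (1 + \<tau>))"
    unfolding powr_add[symmetric] by simp
  finally have qn: "q powr \<beta> * real n = real n powr (- (1 + \<tau>))" .
  define A where "A = {1..n} - {i}"
  obtain R where R: "0 \<le> R" and W: "\<And>t. gbe_weight \<beta> n (x(i := t))
      = R * norm (weighted_poly n A x (of_real t)) powr \<beta>"
    using gbe_weight_update[OF ik(1), of \<beta> x, folded A_def] by blast
  have "ennreal (gbe_weight \<beta> n x * (1 + (x i)\<^sup>2))
      = ennreal R * ennreal (norm (weighted_poly n A x (of_real (x i))) powr \<beta> * (1 + (x i)\<^sup>2))"
    using W[of "x i"] R by (simp add: ennreal_mult[symmetric] mult.assoc)
  also have "\<dots> \<le> ennreal R * (ennreal (q powr \<beta> * real n)
      * (\<integral>\<^sup>+t. ennreal (norm (weighted_poly n A x (of_real t)) powr \<beta>) \<partial>lborel))"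
    using ik by (intro mult_left_mono weighted_poly_near_zero[of A n \<beta> q k] n \<beta> q gap)
      (auto simp: A_def)
  also have "\<dots> = ennreal (real n powr (- (1 + \<tau>)))
      * (\<integral>\<^sup>+t. ennreal R * ennreal (norm (weighted_poly n A x (of_real t)) powr \<beta>) \<partial>lborel)"
    unfolding qn by (subst nn_integral_cmult) (auto simp: mult_ac)
  also have "\<dots> = ennreal (real n powr (- (1 + \<tau>)))
      * (\<integral>\<^sup>+t. ennreal (gbe_weight \<beta> n (x(i := t))) \<partial>lborel)"
    using R by (simp add: W ennreal_mult)
  finally show thesis using that ik(1) by blast
qed

section \<open>Integrating out one coordinate\<close>

lemma nn_integral_cauchy: "(\<integral>\<^sup>+t. ennreal (1 / (1 + t\<^sup>2)) \<partial>lborel) = ennreal pi"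
proof -
  have "integrable lborel (\<lambda>t::real. inverse (1 + t\<^sup>2))"
    using integrable_inverse_1_plus_square by (simp add: set_integrable_def)
  moreover have "(\<integral>t. inverse (1 + t\<^sup>2) \<partial>lborel) = pi"
    using LBINT_inverse_1_plus_square by (simp add: interval_lebesgue_integral_def set_lebesgue_integral_def)
  ultimately show ?thesis
    using nn_integral_eq_integral[of lborel "\<lambda>t::real. inverse (1 + t\<^sup>2)"]
    by (simp add: inverse_eq_divide)
qed

text \<open>The inner integral does not depend on \<open>x i\<close>, since that coordinate is
  overwritten. By Tonelli the Cauchy weight integrates to \<open>pi\<close> and the inner integral
  rebuilds the full one.\<close>

lemma resampling_identity:
  assumes i: "i \<in> {1..n}" and W [measurable]: "W \<in> borel_measurable (lebesgue_pow n)"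
  shows "(\<integral>\<^sup>+x. ennreal (1 / (1 + (x i)\<^sup>2)) * (\<integral>\<^sup>+t. W (x(i := t)) \<partial>lborel) \<partial>lebesgue_pow n)
    = ennreal pi * (\<integral>\<^sup>+x. W x \<partial>lebesgue_pow n)"
    and "(\<lambda>x. ennreal (1 / (1 + (x i)\<^sup>2)) * (\<integral>\<^sup>+t. W (x(i := t)) \<partial>lborel))
      \<in> borel_measurable (lebesgue_pow n)"
proof -
  interpret product_sigma_finite "\<lambda>_::nat. lborel :: real measure"
    by standard
  define I where "I = {1..n} - {i}"
  have I: "finite I" "i \<notin> I" "insert i I = {1..n}" using i by (auto simp: I_def)
  have upd: "(\<lambda>(x, t). x(i := t)) \<in> measurable (lebesgue_pow n \<Otimes>\<^sub>M lborel) (lebesgue_pow n)"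
    using I unfolding case_prod_beta by (intro measurable_fun_upd[where J="{1..n}"]) auto
  have [measurable]: "(\<lambda>(x, t). W (x(i := t))) \<in> borel_measurable (lebesgue_pow n \<Otimes>\<^sub>M lborel)"
    using measurable_compose[OF upd W] by (simp add: case_prod_beta)
  have updI: "(\<lambda>(x, t). x(i := t)) \<in> measurable (PiM I (\<lambda>_. lborel) \<Otimes>\<^sub>M lborel) (lebesgue_pow n)"
    using I unfolding case_prod_beta by (intro measurable_fun_upd[where J="I"]) auto
  have [measurable]: "(\<lambda>(x, t). W (x(i := t))) \<in> borel_measurable (PiM I (\<lambda>_. lborel) \<Otimes>\<^sub>M lborel)"
    using measurable_compose[OF updI W] by (simp add: case_prod_beta)
  note [measurable] = coordinate_borel_measurable[OF i]
  show meas: "(\<lambda>x. ennreal (1 / (1 + (x i)\<^sup>2)) * (\<integral>\<^sup>+t. W (x(i := t)) \<partial>lborel))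
      \<in> borel_measurable (lebesgue_pow n)"
    by measurable
  have "(\<integral>\<^sup>+x. ennreal (1 / (1 + (x i)\<^sup>2)) * (\<integral>\<^sup>+t. W (x(i := t)) \<partial>lborel) \<partial>lebesgue_pow n)
      = (\<integral>\<^sup>+x. (\<integral>\<^sup>+s. ennreal (1 / (1 + s\<^sup>2)) * (\<integral>\<^sup>+t. W (x(i := t)) \<partial>lborel) \<partial>lborel)
          \<partial>PiM I (\<lambda>_. lborel))"
    using product_nn_integral_insert[OF I(1,2), unfolded I(3), OF meas] by simp
  also have "\<dots> = (\<integral>\<^sup>+x. ennreal pi * (\<integral>\<^sup>+t. W (x(i := t)) \<partial>lborel) \<partial>PiM I (\<lambda>_. lborel))"
    by (intro nn_integral_cong) (simp add: nn_integral_multc nn_integral_cauchy)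
  also have "\<dots> = ennreal pi * (\<integral>\<^sup>+x. (\<integral>\<^sup>+t. W (x(i := t)) \<partial>lborel) \<partial>PiM I (\<lambda>_. lborel))"
    by (rule nn_integral_cmult) measurable
  also have "(\<integral>\<^sup>+x. (\<integral>\<^sup>+t. W (x(i := t)) \<partial>lborel) \<partial>PiM I (\<lambda>_. lborel))
      = (\<integral>\<^sup>+x. W x \<partial>lebesgue_pow n)"
    using product_nn_integral_insert[OF I(1,2), unfolded I(3), OF W] by simp
  finally show "(\<integral>\<^sup>+x. ennreal (1 / (1 + (x i)\<^sup>2)) * (\<integral>\<^sup>+t. W (x(i := t)) \<partial>lborel) \<partial>lebesgue_pow n)
    = ennreal pi * (\<integral>\<^sup>+x. W x \<partial>lebesgue_pow n)" .
qed

subsection \<open>Normalization\<close>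

text \<open>Half of the quadratic term absorbs the linear one by completing the square; the other
  half dominates \<open>1 + t\<^sup>2\<close> up to the factor \<open>max 1 (2 / b)\<close>.\<close>

lemma exp_abs_minus_square_bound:
  fixes a b :: real
  assumes "0 < b"
  shows "exp (a * \<bar>t\<bar> - b * t\<^sup>2) \<le> max 1 (2 / b) * exp (a\<^sup>2 / (2 * b)) * (1 / (1 + t\<^sup>2))"
proof -
  define m where "m = max 1 (2 / b)"
  have m: "1 \<le> m" "1 \<le> m * (b / 2)"
    using assms by (auto simp: m_def max_def field_simps)
  have "1 * 1 + 1 * t\<^sup>2 \<le> m * 1 + m * (b / 2) * t\<^sup>2"
    using m by (intro add_mono mult_right_mono) auto
  also have "\<dots> = m * (1 + b / 2 * t\<^sup>2)" by (simp add: algebra_simps)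
  also have "\<dots> \<le> m * exp (b / 2 * t\<^sup>2)"
    using m by (intro mult_left_mono exp_ge_add_one_self) auto
  finally have 1: "1 + t\<^sup>2 \<le> m * exp (b / 2 * t\<^sup>2)" by simp
  have "0 \<le> (a - b * \<bar>t\<bar>)\<^sup>2 / (2 * b)" using assms by simp
  also have "\<dots> = a\<^sup>2 / (2 * b) - (a * \<bar>t\<bar> - b / 2 * t\<^sup>2)"
    using assms by (simp add: power2_diff power_mult_distrib field_simps power2_eq_square)
  finally have "exp (a * \<bar>t\<bar> - b * t\<^sup>2) \<le> exp (a\<^sup>2 / (2 * b) - b / 2 * t\<^sup>2)"
    by (simp add: algebra_simps)
  then have "exp (a * \<bar>t\<bar> - b * t\<^sup>2) * (1 + t\<^sup>2)
      \<le> exp (a\<^sup>2 / (2 * b) - b / 2 * t\<^sup>2) * (m * exp (b / 2 * t\<^sup>2))"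
    using 1 by (intro mult_mono) auto
  also have "\<dots> = m * exp (a\<^sup>2 / (2 * b))"
    by (simp add: exp_diff)
  finally show ?thesis
    unfolding m_def[symmetric] by (simp add: pos_le_divide_eq add_pos_nonneg)
qed

text \<open>Every difference is at most \<open>exp T\<close> with \<open>T\<close> the sum of the
  moduli, and there are at most \<open>n * n\<close> pairs. The bound is crude but factorizes, which
  reduces finiteness of the normalizing constant to one dimension.\<close>

lemma gbe_weight_le_prod:
  assumes "0 < \<beta>"
  shows "gbe_weight \<beta> n x
    \<le> (\<Prod>l\<in>{1..n}. exp (real (n * n) * \<beta> * \<bar>x l\<bar> - real n * \<beta> / 4 * (x l)\<^sup>2))"
proof -
  define T where "T = (\<Sum>l\<in>{1..n}. \<bar>x l\<bar>)"
  have T0: "0 \<le> T" by (simp add: T_def sum_nonneg)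
  have E: "1 \<le> exp (\<beta> * T)" using T0 assms by simp
  have pair: "\<bar>x k - x j\<bar> powr \<beta> \<le> exp (\<beta> * T)" if "j \<in> {1..n}" "k \<in> {1..<j}" for j k
  proof -
    have "\<bar>x k - x j\<bar> \<le> (\<Sum>l\<in>{k, j}. \<bar>x l\<bar>)" using that by auto
    also have "\<dots> \<le> T"
      unfolding T_def using that by (intro sum_mono2) auto
    also have "\<dots> \<le> exp T" using exp_ge_add_one_self[of T] by linarith
    finally have "\<bar>x k - x j\<bar> powr \<beta> \<le> exp T powr \<beta>"
      using assms by (intro powr_mono2) auto
    then show ?thesis by (simp add: exp_powr_real mult.commute)
  qed
  have "(\<Prod>j\<in>{1..n}. \<Prod>k\<in>{1..<j}. \<bar>x k - x j\<bar> powr \<beta>) \<le> (\<Prod>j\<in>{1..n}. exp (\<beta> * T) ^ n)"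
  proof (intro prod_mono conjI prod_nonneg ballI)
    fix j assume j: "j \<in> {1..n}"
    have "(\<Prod>k\<in>{1..<j}. \<bar>x k - x j\<bar> powr \<beta>) \<le> (\<Prod>k\<in>{1..<j}. exp (\<beta> * T))"
      using pair j by (intro prod_mono) auto
    also have "\<dots> = exp (\<beta> * T) ^ (j - 1)" by simp
    also have "\<dots> \<le> exp (\<beta> * T) ^ n" using E j by (intro power_increasing) auto
    finally show "(\<Prod>k\<in>{1..<j}. \<bar>x k - x j\<bar> powr \<beta>) \<le> exp (\<beta> * T) ^ n" .
  qed auto
  also have "\<dots> = exp (real (n * n) * \<beta> * T)"
    by (simp add: power_mult[symmetric] exp_of_nat_mult[symmetric] mult_ac)
  finally have "gbe_weight \<beta> n x \<le> exp (real (n * n) * \<beta> * T)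
      * exp (- (real n * (\<beta> / 2) * (\<Sum>j\<in>{1..n}. (1 / 2) * (x j)\<^sup>2)))"
    unfolding gbe_weight_def by (intro mult_right_mono) auto
  also have "\<dots> = exp (\<Sum>l\<in>{1..n}. real (n * n) * \<beta> * \<bar>x l\<bar> - real n * \<beta> / 4 * (x l)\<^sup>2)"
    unfolding exp_add[symmetric] T_def sum_distrib_left sum_subtractf
    by (simp add: sum_distrib_left mult_ac)
  finally show ?thesis by (simp add: exp_sum)
qed

lemma nn_integral_gbe_weight_finite:
  assumes "0 < \<beta>"
  shows "(\<integral>\<^sup>+x. ennreal (gbe_weight \<beta> n x) \<partial>lebesgue_pow n) < \<infinity>"
proof -
  interpret product_sigma_finite "\<lambda>_::nat. lborel :: real measure"
    by standard
  define h where "h = (\<lambda>t. exp (real (n * n) * \<beta> * \<bar>t\<bar> - real n * \<beta> / 4 * t\<^sup>2))"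
  have [measurable]: "h \<in> borel_measurable borel" unfolding h_def by measurable
  have "(\<integral>\<^sup>+x. ennreal (gbe_weight \<beta> n x) \<partial>lebesgue_pow n)
      \<le> (\<integral>\<^sup>+x. (\<Prod>l\<in>{1..n}. ennreal (h (x l))) \<partial>lebesgue_pow n)"
    using gbe_weight_le_prod[OF assms, of n]
    by (intro nn_integral_mono) (auto simp: h_def prod_ennreal intro!: ennreal_leI)
  also have "\<dots> = (\<Prod>l\<in>{1..n}. \<integral>\<^sup>+t. ennreal (h t) \<partial>lborel)"
    by (rule product_nn_integral_prod) auto
  also have "\<dots> < \<infinity>"
  proof -
    have fin: "(\<integral>\<^sup>+t. ennreal (h t) \<partial>lborel) < \<infinity>" if "n \<ge> 1"
    proof -
      define b where "b = real n * \<beta> / 4"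
      define a where "a = real (n * n) * \<beta>"
      define C where "C = max 1 (2 / b) * exp (a\<^sup>2 / (2 * b))"
      have b: "0 < b" using that assms by (simp add: b_def)
      have "(\<integral>\<^sup>+t. ennreal (h t) \<partial>lborel) \<le> (\<integral>\<^sup>+t. ennreal C * ennreal (1 / (1 + t\<^sup>2)) \<partial>lborel)"
      proof (intro nn_integral_mono)
        fix t
        have "h t \<le> C * (1 / (1 + t\<^sup>2))"
          using exp_abs_minus_square_bound[OF b, of a t] by (simp only: h_def C_def a_def b_def)
        moreover have "0 \<le> C" by (simp add: C_def)
        ultimately show "ennreal (h t) \<le> ennreal C * ennreal (1 / (1 + t\<^sup>2))"
          by (simp only: ennreal_mult'[symmetric] ennreal_leI)
      qed
      also have "\<dots> = ennreal C * ennreal pi"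
        by (simp add: nn_integral_cmult nn_integral_cauchy)
      also have "\<dots> < \<infinity>" by (simp add: ennreal_mult_less_top)
      finally show ?thesis .
    qed
    show ?thesis
    \<comment> \<open>The Gaussian rate is positive only for \<open>n \<ge> 1\<close>; for
      \<open>n = 0\<close> the product is empty.\<close>
    proof (cases "n \<ge> 1")
      case True
      obtain r where r: "0 \<le> r" "(\<integral>\<^sup>+t. ennreal (h t) \<partial>lborel) = ennreal r"
        using fin[OF True] by (metis ennreal_cases less_irrefl infinity_ennreal_def)
      show ?thesis unfolding r(2) prod_constant ennreal_power[OF r(1)] by simp
    qed simp
  qed
  finally show ?thesis .
qed

text \<open>On the box with sides \<open>[j, j + 1/2]\<close> the coordinates are strictly
  increasing, so the weight is positive there, and the box has positive measure.\<close>

lemma nn_integral_gbe_weight_pos: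
  assumes "0 < \<beta>"
  shows "(\<integral>\<^sup>+x. ennreal (gbe_weight \<beta> n x) \<partial>lebesgue_pow n) \<noteq> 0"
proof
  interpret product_sigma_finite "\<lambda>_::nat. lborel :: real measure"
    by standard
  define B where "B = (\<Pi>\<^sub>E j\<in>{1..n}. {real j..real j + 1 / 2})"
  assume "(\<integral>\<^sup>+x. ennreal (gbe_weight \<beta> n x) \<partial>lebesgue_pow n) = 0"
  then have 0: "emeasure (lebesgue_pow n) {x \<in> space (lebesgue_pow n). ennreal (gbe_weight \<beta> n x) \<noteq> 0} = 0"
    by (rule iffD1[OF nn_integral_0_iff, rotated]) measurable
  have sub: "B \<subseteq> {x \<in> space (lebesgue_pow n). ennreal (gbe_weight \<beta> n x) \<noteq> 0}"
  proof
    fix x assume x: "x \<in> B"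
    have xs: "real j \<le> x j \<and> x j \<le> real j + 1 / 2" if "j \<in> {1..n}" for j
      using x that unfolding B_def by (auto dest: PiE_mem)
    have "0 < \<bar>x k - x j\<bar> powr \<beta>" if "j \<in> {1..n}" "k \<in> {1..<j}" for j k
    proof -
      have "real k + 1 \<le> real j" using that by simp
      then have "x k < x j" using xs[of j] xs[of k] that by fastforce
      then show ?thesis by simp
    qed
    then have "0 < gbe_weight \<beta> n x"
      unfolding gbe_weight_def by (intro mult_pos_pos prod_pos) auto
    moreover have "x \<in> space (lebesgue_pow n)"
      using x by (auto simp: B_def space_PiM)
    ultimately show "x \<in> {x \<in> space (lebesgue_pow n). ennreal (gbe_weight \<beta> n x) \<noteq> 0}"
      by auto
  qed
  have "emeasure (lebesgue_pow n) B = 0"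
    by (rule emeasure_eq_0[OF _ 0 sub]) measurable
  moreover have "emeasure (lebesgue_pow n) B = (\<Prod>j\<in>{1..n}. emeasure lborel {real j..real j + 1 / 2})"
    unfolding B_def by (rule emeasure_PiM) auto
  ultimately show False by (simp add: prod_zero_iff)
qed

lemma sets_gbe [measurable_cong]: "sets (gbe \<beta> n) = sets (lebesgue_pow n)"
  by (simp add: gbe_def)

text \<open>A Bochner integral takes the default value 0 for a non-integrable function; the
  finiteness bound excludes this.\<close>

lemma ennreal_gbe_Z:
  assumes "0 < \<beta>"
  shows "ennreal (gbe_Z \<beta> n) = (\<integral>\<^sup>+x. ennreal (gbe_weight \<beta> n x) \<partial>lebesgue_pow n)"
proof -
  have "integrable (lebesgue_pow n) (gbe_weight \<beta> n)"
    using nn_integral_gbe_weight_finite[OF assms, of n]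
    by (intro integrableI_nonneg gbe_weight_measurable) (simp_all add: gbe_weight_nonneg)
  then show ?thesis
    unfolding gbe_Z_def by (intro nn_integral_eq_integral[symmetric]) (simp_all add: gbe_weight_nonneg)
qed

lemma gbe_Z_pos:
  assumes "0 < \<beta>"
  shows "0 < gbe_Z \<beta> n"
  using nn_integral_gbe_weight_pos[OF assms, of n]
  unfolding ennreal_gbe_Z[OF assms, symmetric] by (simp add: ennreal_eq_0_iff)

text \<open>Multiplying through by the normalizing constant avoids division in
  \<open>ennreal\<close>.\<close>

lemma emeasure_gbe:
  assumes \<beta>: "0 < \<beta>" and S [measurable]: "S \<in> sets (lebesgue_pow n)"
  shows "ennreal (gbe_Z \<beta> n) * emeasure (gbe \<beta> n) S
    = (\<integral>\<^sup>+x. ennreal (gbe_weight \<beta> n x) * indicator S x \<partial>lebesgue_pow n)"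
proof -
  have [measurable]: "gbe_density \<beta> n \<in> borel_measurable (lebesgue_pow n)"
    unfolding gbe_density_def[abs_def] by measurable
  have "emeasure (gbe \<beta> n) S
      = (\<integral>\<^sup>+x. ennreal (gbe_density \<beta> n x) * indicator S x \<partial>lebesgue_pow n)"
    unfolding gbe_def by (rule emeasure_density) measurable
  also have "ennreal (gbe_Z \<beta> n) * \<dots>
      = (\<integral>\<^sup>+x. ennreal (gbe_Z \<beta> n) * (ennreal (gbe_density \<beta> n x) * indicator S x) \<partial>lebesgue_pow n)"
    by (rule nn_integral_cmult[symmetric]) measurable
  also have "\<dots> = (\<integral>\<^sup>+x. ennreal (gbe_weight \<beta> n x) * indicator S x \<partial>lebesgue_pow n)"
  proof (intro nn_integral_cong)
    fix x
    have "ennreal (gbe_Z \<beta> n) * ennreal (gbe_density \<beta> n x) = ennreal (gbe_weight \<beta> n x)"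
      using gbe_Z_pos[OF \<beta>, of n] gbe_weight_nonneg[of \<beta> n x]
      by (simp add: gbe_density_def ennreal_mult[symmetric])
    then show "ennreal (gbe_Z \<beta> n) * (ennreal (gbe_density \<beta> n x) * indicator S x)
        = ennreal (gbe_weight \<beta> n x) * indicator S x"
      by (simp only: mult.assoc[symmetric])
  qed
  finally show ?thesis .
qed

lemma prob_space_gbe:
  assumes "0 < \<beta>"
  shows "prob_space (gbe \<beta> n)"
proof
  have sp: "space (gbe \<beta> n) = space (lebesgue_pow n)" by (simp add: gbe_def)
  have "ennreal (gbe_Z \<beta> n) * emeasure (gbe \<beta> n) (space (gbe \<beta> n))
      = (\<integral>\<^sup>+x. ennreal (gbe_weight \<beta> n x) * indicator (space (lebesgue_pow n)) x \<partial>lebesgue_pow n)"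
    unfolding sp by (rule emeasure_gbe[OF assms sets.top])
  also have "\<dots> = ennreal (gbe_Z \<beta> n) * 1"
    unfolding ennreal_gbe_Z[OF assms] mult_1_right by (intro nn_integral_cong) simp
  finally show "emeasure (gbe \<beta> n) (space (gbe \<beta> n)) = 1"
    unfolding ennreal_mult_cancel_left using gbe_Z_pos[OF assms, of n] by simp
qed

lemma gbe_small_spacing_sets:
  "{x \<in> space (gbe \<beta> n). spacing n x < a} \<in> sets (gbe \<beta> n)"
  by measurable

subsection \<open>Small spacings are rare\<close>

lemma gbe_small_spacing_bound:
  assumes n: "n \<ge> 1" and \<beta>: "1 \<le> \<beta>" and \<tau>: "0 < \<tau>"
  shows "measure (gbe \<beta> n) {x \<in> space (gbe \<beta> n).
      spacing n x < ereal (1 / (16 * disc_const\<^sup>2) * real n powr (- ((2 + \<tau>) / \<beta>)))}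
    \<le> pi * real n powr (- \<tau>)" (is "measure _ ?S \<le> _")
proof -
  have \<beta>0: "0 < \<beta>" using \<beta> by simp
  interpret prob_space "gbe \<beta> n" by (rule prob_space_gbe[OF \<beta>0])
  define w where "w = gbe_Z \<beta> n"
  have w: "0 < w" unfolding w_def by (rule gbe_Z_pos[OF \<beta>0])
  define \<delta> where "\<delta> = real n powr (- (1 + \<tau>))"
  define H where "H = (\<lambda>j x. ennreal (1 / (1 + (x j)\<^sup>2))
      * (\<integral>\<^sup>+t. ennreal (gbe_weight \<beta> n (x(j := t))) \<partial>lborel))"
  have W: "(\<lambda>x. ennreal (gbe_weight \<beta> n x)) \<in> borel_measurable (lebesgue_pow n)"
    by measurable
  have H: "(\<integral>\<^sup>+x. H j x \<partial>lebesgue_pow n) = ennreal pi * ennreal w"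
      and H_meas: "H j \<in> borel_measurable (lebesgue_pow n)" if "j \<in> {1..n}" for j
    unfolding H_def w_def ennreal_gbe_Z[OF \<beta>0] by (rule resampling_identity[OF that W])+
  have pointwise: "ennreal (gbe_weight \<beta> n x) * indicator ?S x \<le> ennreal \<delta> * (\<Sum>j\<in>{1..n}. H j x)"
    for x
  proof (cases "x \<in> ?S")
    case True
    then obtain j where j: "j \<in> {1..n}"
      and le: "ennreal (gbe_weight \<beta> n x * (1 + (x j)\<^sup>2))
        \<le> ennreal \<delta> * (\<integral>\<^sup>+t. ennreal (gbe_weight \<beta> n (x(j := t))) \<partial>lborel)"
      using spacing_small_imp[OF n \<beta> \<tau>, of x] unfolding \<delta>_def by blast
    define p where "p = 1 + (x j)\<^sup>2"
    have p: "0 < p" by (simp add: p_def add_pos_nonneg)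
    have "ennreal (gbe_weight \<beta> n x) = ennreal (1 / p) * ennreal (gbe_weight \<beta> n x * p)"
      using p gbe_weight_nonneg[of \<beta> n x] by (simp add: ennreal_mult[symmetric])
    also have "\<dots> \<le> ennreal (1 / p)
        * (ennreal \<delta> * (\<integral>\<^sup>+t. ennreal (gbe_weight \<beta> n (x(j := t))) \<partial>lborel))"
      using le unfolding p_def by (intro mult_left_mono) auto
    also have "\<dots> = ennreal \<delta> * H j x"
      unfolding H_def p_def by (simp only: mult_ac)
    \<comment> \<open>The index \<open>j\<close> depends on \<open>x\<close>; the sum over all
      coordinates dominates every choice.\<close>
    also have "\<dots> \<le> ennreal \<delta> * (\<Sum>j\<in>{1..n}. H j x)"
      using j by (intro mult_left_mono member_le_sum) auto
    finally show ?thesis using True by simp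
  qed auto
  have S: "?S \<in> sets (lebesgue_pow n)"
    unfolding sets_gbe[of \<beta> n, symmetric] by (rule gbe_small_spacing_sets)
  have "ennreal w * emeasure (gbe \<beta> n) ?S
      \<le> (\<integral>\<^sup>+x. ennreal \<delta> * (\<Sum>j\<in>{1..n}. H j x) \<partial>lebesgue_pow n)"
    unfolding w_def emeasure_gbe[OF \<beta>0 S] by (intro nn_integral_mono pointwise)
  also have "\<dots> = ennreal \<delta> * (\<Sum>j\<in>{1..n}. \<integral>\<^sup>+x. H j x \<partial>lebesgue_pow n)"
    by (simp only: nn_integral_cmult borel_measurable_sum nn_integral_sum H_meas)
  also have "\<dots> = ennreal \<delta> * (\<Sum>j\<in>{1..n}. ennreal pi * ennreal w)"
    using H by simp
  also have "\<dots> = ennreal (\<delta> * real n * pi * w)"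
    using w by (simp add: ennreal_mult \<delta>_def ennreal_of_nat_eq_real_of_nat mult_ac)
  \<comment> \<open>The \<open>n\<close> coordinates cost one factor \<open>n\<close>, absorbed by
    the exponent \<open>1 + \<tau>\<close>.\<close>
  also have "\<delta> * real n = real n powr (- \<tau>)"
    using n by (simp add: \<delta>_def powr_diff powr_minus_divide)
  finally have "ennreal (w * measure (gbe \<beta> n) ?S) \<le> ennreal (real n powr (- \<tau>) * pi * w)"
    using w by (simp add: emeasure_eq_measure ennreal_mult)
  then have "w * measure (gbe \<beta> n) ?S \<le> real n powr (- \<tau>) * pi * w"
    using w by (subst (asm) ennreal_le_iff) auto
  then show ?thesis using w by (simp add: mult_ac)
qed

section \<open>The almost sure lower bound\<close>

lemma gbe_seq_spacing_liminf:
  fixes c0 :: real and \<beta> :: "nat \<Rightarrow> real"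
  assumes c0: "0 < c0" and \<beta>: "\<And>n. n \<ge> 1 \<Longrightarrow> \<beta> n > 0"
    and growth: "\<forall>\<^sub>F n in sequentially. \<beta> n \<ge> c0 * ln (real n)"
  shows "AE \<omega> in gbe_seq \<beta>. liminf (\<lambda>n. spacing n (\<omega> n))
    \<ge> ereal (1 / (16 * disc_const\<^sup>2) * exp (- (4 / c0)))" (is "AE \<omega> in _. _ \<ge> ereal ?s0")
proof -
  define c where "c = 1 / (16 * disc_const\<^sup>2)"
  have c: "0 < c" using disc_const_ge_1 by (simp add: c_def)
  have prob: "prob_space (gbe (\<beta> n) n)" if "n \<in> {1..}" for n
    using that \<beta> by (intro prob_space_gbe) auto
  interpret P: prob_space "gbe_seq \<beta>"
    unfolding gbe_seq_def by (rule prob_space_PiM[OF prob])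
  \<comment> \<open>Together with the growth of \<open>\<beta>\<close> this yields
    \<open>\<beta> n \<ge> 1\<close>, the range of the bound for a single \<open>n\<close>.\<close>
  have "\<forall>\<^sub>F n in sequentially. 1 / c0 \<le> ln (real n)" by real_asymp
  with growth have "\<forall>\<^sub>F n in sequentially. \<beta> n \<ge> c0 * ln (real n) \<and> 1 / c0 \<le> ln (real n) \<and> 1 \<le> n"
    using eventually_ge_at_top[of 1] by eventually_elim auto
  then obtain N where N: "\<And>n. n \<ge> N \<Longrightarrow> \<beta> n \<ge> c0 * ln (real n) \<and> 1 / c0 \<le> ln (real n) \<and> 1 \<le> n"
    unfolding eventually_sequentially by blast
  define E where "E = (\<lambda>n. {x \<in> space (gbe (\<beta> n) n). spacing n x < ereal ?s0})"
  \<comment> \<open>Finitely many indices do not affect the limit. Emptying the events below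
    \<open>N\<close> also removes index 0, which is not a coordinate of
    \<open>gbe_seq\<close>.\<close>
  define A where "A = (\<lambda>n. if n \<ge> N then {\<omega> \<in> space (gbe_seq \<beta>). \<omega> n \<in> E n} else {})"
  have E_sets: "E n \<in> sets (gbe (\<beta> n) n)" for n
    unfolding E_def by (rule gbe_small_spacing_sets)
  have coord: "(\<lambda>\<omega>. \<omega> n) \<in> measurable (gbe_seq \<beta>) (gbe (\<beta> n) n)" if "n \<ge> N" for n
    unfolding gbe_seq_def using N[OF that] by (intro measurable_component_singleton) auto
  have A_eq: "A n = (\<lambda>\<omega>. \<omega> n) -` E n \<inter> space (gbe_seq \<beta>)" if "n \<ge> N" for n
    using that by (auto simp: A_def)
  have A_sets: "A n \<in> sets (gbe_seq \<beta>)" for n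
    using measurable_sets[OF coord E_sets] A_eq by (cases "n \<ge> N") (auto simp: A_def)
  have bound: "measure (gbe_seq \<beta>) (A n) \<le> pi * real n powr (- 2)" if n: "n \<ge> N" for n
  proof -
    have n1: "1 \<le> n" and ln: "\<beta> n \<ge> c0 * ln (real n)" "1 / c0 \<le> ln (real n)"
      using N[OF n] by auto
    have "1 \<le> c0 * ln (real n)" using ln(2) c0 by (simp add: field_simps)
    then have \<beta>1: "1 \<le> \<beta> n" using ln(1) by linarith
    \<comment> \<open>The marginal of the product measure at \<open>n\<close> is
      \<open>gbe (\<beta> n) n\<close>, so each event is estimated on its own factor.\<close>
    have "distr (gbe_seq \<beta>) (gbe (\<beta> n) n) (\<lambda>\<omega>. \<omega> n) = gbe (\<beta> n) n"
      unfolding gbe_seq_def using n1 prob by (intro distr_PiM_component) auto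
    then have "measure (gbe_seq \<beta>) (A n) = measure (gbe (\<beta> n) n) (E n)"
      using measure_distr[OF coord[OF n] E_sets] A_eq[OF n] by simp
    also have "\<dots> \<le> measure (gbe (\<beta> n) n) {x \<in> space (gbe (\<beta> n) n).
        spacing n x < ereal (c * real n powr (- ((2 + 2) / \<beta> n)))}"
    proof -
      interpret prob_space "gbe (\<beta> n) n" using n1 by (intro prob) auto
      \<comment> \<open>For \<open>\<tau> = 2\<close> the threshold is
        \<open>n powr (- (4 / \<beta> n))\<close>, and the growth of \<open>\<beta>\<close> keeps it
        above \<open>exp (- (4 / c0))\<close>; this is where the limiting constant comes
        from.\<close>
      have "4 * (c0 * ln (real n)) \<le> 4 * \<beta> n" using ln(1) by simp
      then have "4 / \<beta> n * ln (real n) \<le> 4 / c0"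
        using c0 \<beta>1 by (simp add: field_simps)
      then have "exp (- (4 / c0)) \<le> real n powr (- ((2 + 2) / \<beta> n))"
        using n1 by (simp add: powr_def)
      then have le: "?s0 \<le> c * real n powr (- ((2 + 2) / \<beta> n))"
        unfolding c_def[symmetric] using c by (intro mult_left_mono) auto
      then have "E n \<subseteq> {x \<in> space (gbe (\<beta> n) n).
          spacing n x < ereal (c * real n powr (- ((2 + 2) / \<beta> n)))}"
        unfolding E_def using less_le_trans[OF _ ereal_less_eq(3)[THEN iffD2, OF le]] by blast
      then show ?thesis by (intro finite_measure_mono gbe_small_spacing_sets)
    qed
    also have "\<dots> \<le> pi * real n powr (- 2)"
      unfolding c_def by (rule gbe_small_spacing_bound[OF n1 \<beta>1]) simp
    finally show ?thesis .
  qed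
  have "summable (\<lambda>n. pi * real n powr (- 2))"
    by (intro summable_mult) (simp add: summable_real_powr_iff)
  then have "summable (\<lambda>n. measure (gbe_seq \<beta>) (A n))"
    by (rule summable_comparison_test_ev[rotated]) (use bound in \<open>auto simp: eventually_sequentially\<close>)
  then have "AE \<omega> in gbe_seq \<beta>. eventually (\<lambda>n. \<omega> \<in> space (gbe_seq \<beta>) - A n) sequentially"
    using A_sets by (intro borel_cantelli_AE1) (auto simp: P.emeasure_eq_measure)
  then show ?thesis
  proof eventually_elim
    fix \<omega> assume ev: "eventually (\<lambda>n. \<omega> \<in> space (gbe_seq \<beta>) - A n) sequentially"
    show "ereal ?s0 \<le> liminf (\<lambda>n. spacing n (\<omega> n))"
    proof (rule Liminf_bounded)
      show "\<forall>\<^sub>F n in sequentially. ereal ?s0 \<le> spacing n (\<omega> n)"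
        using ev eventually_ge_at_top[of N]
      proof eventually_elim
        fix n assume \<omega>: "\<omega> \<in> space (gbe_seq \<beta>) - A n" and n: "N \<le> n"
        then have "\<omega> n \<in> space (gbe (\<beta> n) n)"
          using measurable_space[OF coord[OF n]] by auto
        then show "ereal ?s0 \<le> spacing n (\<omega> n)"
          using \<omega> n by (auto simp: A_def E_def not_less)
      qed
    qed
  qed
qed

theorem theorem1p10:
  shows "(\<exists>c>0::real. \<exists>C>0::real. \<forall>\<beta>\<ge>1::real. \<forall>\<tau>>0::real. \<forall>n\<ge>1::nat.
            measure (gbe \<beta> n)
              {x \<in> space (gbe \<beta> n). spacing n x < ereal (c * real n powr (- ((2 + \<tau>) / \<beta>)))}
            < C * (real n powr (- \<tau>) + exp (- (real n * \<beta> / C))))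
       \<and> (\<forall>c0>0::real. \<exists>s0>0::real. \<forall>\<beta> :: nat \<Rightarrow> real.
            (\<forall>n\<ge>1. \<beta> n > 0) \<and> (\<forall>\<^sub>F n in sequentially. \<beta> n \<ge> c0 * ln (real n)) \<longrightarrow>
            (AE \<omega> in gbe_seq \<beta>. liminf (\<lambda>n. spacing n (\<omega> n)) \<ge> ereal s0))"
proof
  define c where "c = 1 / (16 * disc_const\<^sup>2)"
  have c: "0 < c" using disc_const_ge_1 by (simp add: c_def)
  show "\<exists>c>0::real. \<exists>C>0::real. \<forall>\<beta>\<ge>1::real. \<forall>\<tau>>0::real. \<forall>n\<ge>1::nat.
            measure (gbe \<beta> n)
              {x \<in> space (gbe \<beta> n). spacing n x < ereal (c * real n powr (- ((2 + \<tau>) / \<beta>)))}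
            < C * (real n powr (- \<tau>) + exp (- (real n * \<beta> / C)))"
  \<comment> \<open>The constant \<open>C = pi\<close> is the total mass of the Cauchy weight.
    Positivity of the exponential term makes the inequality strict.\<close>
  proof (rule exI[of _ c], intro conjI c, rule exI[of _ pi], intro conjI pi_gt_zero allI impI)
    fix \<beta> \<tau> :: real and n :: nat
    assume "1 \<le> \<beta>" "0 < \<tau>" "1 \<le> n"
    then have "measure (gbe \<beta> n)
        {x \<in> space (gbe \<beta> n). spacing n x < ereal (c * real n powr (- ((2 + \<tau>) / \<beta>)))}
        \<le> pi * real n powr (- \<tau>)"
      unfolding c_def by (intro gbe_small_spacing_bound)
    also have "\<dots> < pi * (real n powr (- \<tau>) + exp (- (real n * \<beta> / pi)))"
      by (intro mult_strict_left_mono) auto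
    finally show "measure (gbe \<beta> n)
        {x \<in> space (gbe \<beta> n). spacing n x < ereal (c * real n powr (- ((2 + \<tau>) / \<beta>)))}
        < pi * (real n powr (- \<tau>) + exp (- (real n * \<beta> / pi)))" .
  qed
  show "\<forall>c0>0::real. \<exists>s0>0::real. \<forall>\<beta> :: nat \<Rightarrow> real.
            (\<forall>n\<ge>1. \<beta> n > 0) \<and> (\<forall>\<^sub>F n in sequentially. \<beta> n \<ge> c0 * ln (real n)) \<longrightarrow>
            (AE \<omega> in gbe_seq \<beta>. liminf (\<lambda>n. spacing n (\<omega> n)) \<ge> ereal s0)"
  proof (intro allI impI)
    fix c0 :: real assume "0 < c0"
    show "\<exists>s0>0::real. \<forall>\<beta> :: nat \<Rightarrow> real.
            (\<forall>n\<ge>1. \<beta> n > 0) \<and> (\<forall>\<^sub>F n in sequentially. \<beta> n \<ge> c0 * ln (real n)) \<longrightarrow>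
            (AE \<omega> in gbe_seq \<beta>. liminf (\<lambda>n. spacing n (\<omega> n)) \<ge> ereal s0)"
    proof (rule exI[of _ "c * exp (- (4 / c0))"], intro conjI allI impI)
      show "0 < c * exp (- (4 / c0))" using c by simp
      fix \<beta> :: "nat \<Rightarrow> real"
      assume "(\<forall>n\<ge>1. \<beta> n > 0) \<and> (\<forall>\<^sub>F n in sequentially. \<beta> n \<ge> c0 * ln (real n))"
      then show "AE \<omega> in gbe_seq \<beta>. liminf (\<lambda>n. spacing n (\<omega> n)) \<ge> ereal (c * exp (- (4 / c0)))"
        unfolding c_def using gbe_seq_spacing_liminf[OF \<open>0 < c0\<close>, of \<beta>] by simp
    qed
  qed
qed

end
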